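(* Let $x_1,x_2\in\mathbb{R}^d$, $r_1,r_2>0$, and set $B_1=B_C(x_1;r_1)$, $B_2=B_C(x_2;r_2)$ and $\tilde d_C(B_1;B_2)=\max(d_C(x_1;x_2)-r_1-r_2,\,0)\in[0,\infty]$. Then the viscosity semigroup $S^{(0)}$ with coefficients $C$ satisfies \[ |(\varphi_1,S^{(0)}_t\varphi_2)|\le e^{-\tilde d_C(B_1;B_2)^2/(4t)}\,\|\varphi_1\|_2\,\|\varphi_2\|_2 \] for all $\varphi_1\in L_2(B_1)$, $\varphi_2\in L_2(B_2)$ and $t>0$, with the convention $e^{-\infty}=0$.
   Context: Let $C=(c_{ij})$ be a $d\times d$ matrix of real-valued $L_\infty(\mathbb{R}^d)$ functions, symmetric and positive semidefinite almost everywhere. Let $L_{2;1}(\mathbb{R}^d)=W^{1,2}(\mathbb{R}^d)$ and define $h(\varphi)=\sum_{i,j=1}^d(\partial_i\varphi,c_{ij}\partial_j\varphi)$, $l(\varphi)=\sum_{i=1}^d\|\partial_i\varphi\|_2^2$, both with domain $L_{2;1}(\mathbb{R}^d)$. For $\varepsilon\in(0,1]$ the form $h_\varepsilon=h+\varepsilon l$ is closed; let $H_\varepsilon$ be the associated positive self-adjoint operator on $L_2(\mathbb{R}^d)$. As $\varepsilon\downarrow0$, $H_\varepsilon$ converges in the strong resolvent sense to a positive self-adjoint operator $H_0$, the viscosity operator with coefficients $C$. The viscosity semigroup is $S^{(0)}_t=e^{-tH_0}$. The pseudodistance $d_C:\mathbb{R}^d\times\mathbb{R}^d\to[0,\infty]$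 is $d_C(x;y)=\sup\{|\psi(x)-\psi(y)|:\psi\in\mathcal D\}$, where $\mathcal D$ is the set of real $\psi\in C_c^\infty(\mathbb{R}^d)$ with $\|\sum_{i,j=1}^d c_{ij}(\partial_i\psi)(\partial_j\psi)\|_\infty\le1$. Balls: $B_C(x;r)=\{y\in\mathbb{R}^d:d_C(x;y)<r\}$. For measurable $V\subseteq\mathbb{R}^d$, $L_2(V)$ denotes the functions in $L_2(\mathbb{R}^d)$ vanishing a.e. outside $V$. *)

theory Defs
  imports "HOL-Analysis.Analysis" "HOL-Probability.Essential_Supremum"
begin

text \<open>
  Elements of \<open>L\<^sub>2(\<real>\<^sup>d)\<close> and \<open>L\<^sub>\<infinity>(\<real>\<^sup>d)\<close> are represented by Lebesgue measurable functions, and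
  equality of classes by equality almost everywhere.  The space \<open>L\<^sub>2\<close> is complex, with
  inner product conjugate-linear in the first argument.
\<close>

section \<open>Function spaces\<close>

definition Linf :: "(real^'n \<Rightarrow> real) set" where
  "Linf = {f \<in> borel_measurable lebesgue. esssup lebesgue (\<lambda>x. ereal \<bar>f x\<bar>) < \<infinity>}"

definition L2 :: "(real^'n \<Rightarrow> complex) set" where
  "L2 = {f \<in> borel_measurable lebesgue. integrable lebesgue (\<lambda>x. (cmod (f x))\<^sup>2)}"

definition L2_on :: "(real^'n) set \<Rightarrow> (real^'n \<Rightarrow> complex) set" where
  "L2_on V = {f \<in> L2. AE x in lebesgue. x \<notin> V \<longrightarrow> f x = 0}"

definition L2_inner :: "(real^'n \<Rightarrow> complex) \<Rightarrow> (real^'n \<Rightarrow> complex) \<Rightarrow> complex" where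
  "L2_inner f g = (LINT x|lebesgue. cnj (f x) * g x)"

definition L2_norm :: "(real^'n \<Rightarrow> complex) \<Rightarrow> real" where
  "L2_norm f = sqrt (LINT x|lebesgue. (cmod (f x))\<^sup>2)"

definition partial :: "'n \<Rightarrow> (real^'n \<Rightarrow> real) \<Rightarrow> real^'n \<Rightarrow> real" where
  "partial i \<psi> x = frechet_derivative \<psi> (at x) (axis i 1)"

text \<open>\<open>C\<^sub>c\<^sup>\<infinity>(\<real>\<^sup>d)\<close>, real-valued; differentiability of all iterated partial derivatives
  includes their continuity.\<close>

definition Cc_infinity :: "(real^'n \<Rightarrow> real) set" where
  "Cc_infinity = {\<psi>. (\<forall>is x. foldr partial is \<psi> differentiable (at x)) \<and>
                     compact (closure {x. \<psi> x \<noteq> 0})}"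

definition is_weak_partial :: "'n \<Rightarrow> (real^'n \<Rightarrow> complex) \<Rightarrow> (real^'n \<Rightarrow> complex) \<Rightarrow> bool" where
  "is_weak_partial i f g \<longleftrightarrow>
     (\<forall>\<eta>\<in>Cc_infinity. (LINT x|lebesgue. f x * of_real (partial i \<eta> x))
                      = - (LINT x|lebesgue. g x * of_real (\<eta> x)))"

definition W12 :: "(real^'n \<Rightarrow> complex) set" where
  "W12 = {f \<in> L2. \<forall>i. \<exists>g\<in>L2. is_weak_partial i f g}"

text \<open>A representative of the weak derivative, which is unique almost everywhere.\<close>

definition weak_partial :: "'n \<Rightarrow> (real^'n \<Rightarrow> complex) \<Rightarrow> (real^'n \<Rightarrow> complex)" where
  "weak_partial i f = (SOME g. g \<in> L2 \<and> is_weak_partial i f g)"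

section \<open>Operators on \<open>L\<^sub>2\<close>\<close>

text \<open>
  An unbounded operator is represented by its graph \<open>H\<close>, the set of all pairs of
  representatives \<open>(u, v)\<close> with \<open>u\<close> in the domain and \<open>v\<close> equal to the image of \<open>u\<close>.
\<close>

type_synonym 'n L2_graph = "((real^'n \<Rightarrow> complex) \<times> (real^'n \<Rightarrow> complex)) set"

definition densely_defined :: "'n::finite L2_graph \<Rightarrow> bool" where
  "densely_defined H \<longleftrightarrow>
     (\<forall>f\<in>L2. \<forall>e>0. \<exists>(u, v)\<in>H. L2_norm (\<lambda>x. f x - u x) < e)"

definition adjoint_graph :: "'n::finite L2_graph \<Rightarrow> 'n L2_graph" where
  "adjoint_graph H =
     {(f, g). f \<in> L2 \<and> g \<in> L2 \<and> (\<forall>(u, v)\<in>H. L2_inner v f = L2_inner u g)}"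

text \<open>Linearity and single-valuedness (modulo null sets) of \<open>H\<close> are consequences of the
  first two conditions.\<close>

definition positive_self_adjoint :: "'n::finite L2_graph \<Rightarrow> bool" where
  "positive_self_adjoint H \<longleftrightarrow>
     densely_defined H \<and> adjoint_graph H = H \<and> (\<forall>(u, v)\<in>H. 0 \<le> Re (L2_inner u v))"

definition bounded_L2_operator :: "((real^'n \<Rightarrow> complex) \<Rightarrow> (real^'n \<Rightarrow> complex)) \<Rightarrow> bool" where
  "bounded_L2_operator T \<longleftrightarrow>
     (\<forall>f\<in>L2. T f \<in> L2) \<and>
     (\<forall>f\<in>L2. \<forall>g\<in>L2. \<forall>a b. AE x in lebesgue.
        T (\<lambda>y. a * f y + b * g y) x = a * T f x + b * T g x) \<and>
     (\<exists>M. \<forall>f\<in>L2. L2_norm (T f) \<le> M * L2_norm f)"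

text \<open>\<open>is_resolvent H \<lambda> R\<close>: the operator \<open>\<lambda>I + H\<close> has the bounded, everywhere defined
  inverse \<open>R\<close>.\<close>

definition is_resolvent ::
    "'n::finite L2_graph \<Rightarrow> real \<Rightarrow> ((real^'n \<Rightarrow> complex) \<Rightarrow> (real^'n \<Rightarrow> complex)) \<Rightarrow> bool" where
  "is_resolvent H l R \<longleftrightarrow>
     bounded_L2_operator R \<and>
     (\<forall>f\<in>L2. \<exists>v. (R f, v) \<in> H \<and> (AE x in lebesgue. of_real l * R f x + v x = f x)) \<and>
     (\<forall>(u, v)\<in>H. AE x in lebesgue. R (\<lambda>y. of_real l * u y + v y) x = u x)"

text \<open>Convergence as \<open>\<epsilon> \<down> 0\<close> in the strong resolvent sense, for a family of positive
  self-adjoint operators indexed by \<open>\<epsilon> \<in> (0, 1]\<close>.\<close>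

definition strong_resolvent_limit :: "(real \<Rightarrow> 'n::finite L2_graph) \<Rightarrow> 'n L2_graph \<Rightarrow> bool" where
  "strong_resolvent_limit H H\<^sub>0 \<longleftrightarrow>
     (\<forall>l>0. \<exists>R R\<^sub>0.
        (\<forall>\<epsilon>\<in>{0<..1}. is_resolvent (H \<epsilon>) l (R \<epsilon>)) \<and> is_resolvent H\<^sub>0 l R\<^sub>0 \<and>
        (\<forall>f\<in>L2. ((\<lambda>\<epsilon>. L2_norm (\<lambda>x. R \<epsilon> f x - R\<^sub>0 f x)) \<longlongrightarrow> 0) (at_right 0)))"

text \<open>The operator associated with a sesquilinear form \<open>q\<close> with domain \<open>D\<close>.\<close>

definition form_operator ::
    "(real^'n \<Rightarrow> complex) set \<Rightarrow> ((real^'n \<Rightarrow> complex) \<Rightarrow> (real^'n \<Rightarrow> complex) \<Rightarrow> complex)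
      \<Rightarrow> 'n::finite L2_graph" where
  "form_operator D q = {(u, v). u \<in> D \<and> v \<in> L2 \<and> (\<forall>w\<in>D. q w u = L2_inner w v)}"

text \<open>\<open>S\<close> is the strongly continuous semigroup \<open>S t = e\<^bsup>-tH\<^esup>\<close>, that is, its generator is \<open>-H\<close>
  (with equality of domains).\<close>

definition semigroup_of ::
    "'n::finite L2_graph \<Rightarrow> (real \<Rightarrow> (real^'n \<Rightarrow> complex) \<Rightarrow> (real^'n \<Rightarrow> complex)) \<Rightarrow> bool" where
  "semigroup_of H S \<longleftrightarrow>
     (\<forall>t\<ge>0. bounded_L2_operator (S t)) \<and>
     (\<forall>f\<in>L2. AE x in lebesgue. S 0 f x = f x) \<and>
     (\<forall>s\<ge>0. \<forall>t\<ge>0. \<forall>f\<in>L2. AE x in lebesgue. S (s + t) f x = S s (S t f) x) \<and>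
     (\<forall>f\<in>L2. ((\<lambda>t. L2_norm (\<lambda>x. S t f x - f x)) \<longlongrightarrow> 0) (at_right 0)) \<and>
     H = {(u, v). u \<in> L2 \<and> v \<in> L2 \<and>
            ((\<lambda>t. L2_norm (\<lambda>x. (S t u x - u x) / of_real t + v x)) \<longlongrightarrow> 0) (at_right 0)}"

section \<open>The viscosity semigroup\<close>

text \<open>The entry \<open>c\<^sub>i\<^sub>j\<close> of \<open>C\<close> at \<open>x\<close> is \<open>C x $ i $ j\<close>.\<close>

definition coefficient_matrix :: "(real^'n \<Rightarrow> real^'n^'n) \<Rightarrow> bool" where
  "coefficient_matrix C \<longleftrightarrow>
     (\<forall>i j. (\<lambda>x. C x $ i $ j) \<in> Linf) \<and>
     (AE x in lebesgue. transpose (C x) = C x \<and> (\<forall>\<xi>. 0 \<le> \<xi> \<bullet> (C x *v \<xi>)))"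

text \<open>The sesquilinear forms whose diagonals are the quadratic forms \<open>h\<close>, \<open>l\<close> and
  \<open>h + \<epsilon> l\<close> on \<open>W12\<close>.\<close>

definition h_form ::
    "(real^'n \<Rightarrow> real^'n^'n) \<Rightarrow> (real^'n \<Rightarrow> complex) \<Rightarrow> (real^'n \<Rightarrow> complex) \<Rightarrow> complex" where
  "h_form C \<phi> \<psi> =
     (\<Sum>i\<in>UNIV. \<Sum>j\<in>UNIV.
        L2_inner (weak_partial i \<phi>) (\<lambda>x. of_real (C x $ i $ j) * weak_partial j \<psi> x))"

definition l_form :: "(real^'n \<Rightarrow> complex) \<Rightarrow> (real^'n \<Rightarrow> complex) \<Rightarrow> complex" where
  "l_form \<phi> \<psi> = (\<Sum>i\<in>UNIV. L2_inner (weak_partial i \<phi>) (weak_partial i \<psi>))"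

definition H_eps :: "(real^'n \<Rightarrow> real^'n^'n) \<Rightarrow> real \<Rightarrow> 'n::finite L2_graph" where
  "H_eps C \<epsilon> = form_operator W12 (\<lambda>\<phi> \<psi>. h_form C \<phi> \<psi> + of_real \<epsilon> * l_form \<phi> \<psi>)"

definition viscosity_operator :: "(real^'n \<Rightarrow> real^'n^'n) \<Rightarrow> 'n::finite L2_graph \<Rightarrow> bool" where
  "viscosity_operator C H\<^sub>0 \<longleftrightarrow>
     positive_self_adjoint H\<^sub>0 \<and> strong_resolvent_limit (H_eps C) H\<^sub>0"

definition viscosity_semigroup ::
    "(real^'n \<Rightarrow> real^'n^'n) \<Rightarrow> (real \<Rightarrow> (real^'n \<Rightarrow> complex) \<Rightarrow> (real^'n \<Rightarrow> complex)) \<Rightarrow> bool" where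
  "viscosity_semigroup C S \<longleftrightarrow> (\<exists>H\<^sub>0. viscosity_operator C H\<^sub>0 \<and> semigroup_of H\<^sub>0 S)"

section \<open>The pseudodistance\<close>

definition test_functions :: "(real^'n \<Rightarrow> real^'n^'n) \<Rightarrow> (real^'n \<Rightarrow> real) set" where
  "test_functions C = {\<psi> \<in> Cc_infinity.
     esssup lebesgue (\<lambda>x. ereal \<bar>\<Sum>i\<in>UNIV. \<Sum>j\<in>UNIV. C x $ i $ j * partial i \<psi> x * partial j \<psi> x\<bar>) \<le> 1}"

definition d_C :: "(real^'n \<Rightarrow> real^'n^'n) \<Rightarrow> real^'n \<Rightarrow> real^'n \<Rightarrow> ereal" where
  "d_C C x y = (SUP \<psi>\<in>test_functions C. ereal \<bar>\<psi> x - \<psi> y\<bar>)"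

definition B_C :: "(real^'n \<Rightarrow> real^'n^'n) \<Rightarrow> real^'n \<Rightarrow> real \<Rightarrow> (real^'n) set" where
  "B_C C x r = {y. d_C C x y < ereal r}"

definition ball_distance ::
    "(real^'n \<Rightarrow> real^'n^'n) \<Rightarrow> real^'n \<Rightarrow> real \<Rightarrow> real^'n \<Rightarrow> real \<Rightarrow> ereal" where
  "ball_distance C x\<^sub>1 r\<^sub>1 x\<^sub>2 r\<^sub>2 = max (d_C C x\<^sub>1 x\<^sub>2 - ereal r\<^sub>1 - ereal r\<^sub>2) 0"

text \<open>\<open>e\<^bsup>-a\<^esup>\<close> for \<open>a \<in> [0, \<infinity>]\<close>.\<close>

definition exp_minus :: "ereal \<Rightarrow> real" where
  "exp_minus a = (if a = \<infinity> then 0 else exp (- real_of_ereal a))"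

end

theory Submission
  imports Defs "HOL-Computational_Algebra.Polynomial"
begin

text \<open>
  For a test function \<open>\<psi>\<close> and real \<open>\<rho>\<close>, testing the form of \<open>H\<^sub>\<epsilon>\<close> with \<open>e\<^bsup>2\<rho>\<psi>\<^esup>u\<close> and completing the
  square gives \<open>Re (e\<^bsup>2\<rho>\<psi>\<^esup>u, H\<^sub>\<epsilon>u) \<ge> -\<rho>\<^sup>2(1 + \<epsilon>K)\<parallel>e\<^bsup>\<rho>\<psi>\<^esup>u\<parallel>\<^sup>2\<close>, where \<open>K\<close> bounds \<open>|\<nabla>\<psi>|\<^sup>2\<close>.  The
  resulting weighted resolvent bound survives \<open>\<epsilon> \<down> 0\<close> and the implicit Euler scheme turns it into
  \<open>\<parallel>e\<^bsup>\<rho>\<psi>\<^esup>S\<^sub>t\<phi>\<parallel> \<le> exp(\<rho>\<^sup>2t)\<parallel>e\<^bsup>\<rho>\<psi>\<^esup>\<phi>\<parallel>\<close>.  Pairing with \<open>e\<^bsup>-\<rho>\<psi>\<^esup>\<phi>\<^sub>1\<close>, using that \<open>\<psi>\<close> varies by less than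
  \<open>r\<^sub>i\<close> on \<open>B\<^sub>i\<close>, and choosing \<open>\<rho> = D/(2t)\<close> for \<open>D\<close> below the distance of the balls gives the bound.
\<close>

section \<open>The space \<open>L\<^sub>2\<close>\<close>

text \<open>Three features of the definitions shape the argument. The limit operator is known only
  through its resolvents, so the form inequality itself cannot be carried to \<epsilon> = 0; a
  resolvent bound at fixed \<open>l\<close> can, because multiplication by e^(\<rho>\<psi>) is
  bounded on \<open>L2\<close>. The semigroup is specified by its generator, with no bound uniform
  in time: the Euler scheme ties it to resolvents, and controlling the accumulated error requires
  local boundedness of t \<mapsto> \<open>S t\<close>, which comes from uniform boundedness and
  hence from summing series in \<open>L2\<close>. Finally, \<open>weak_partial\<close> is an
  arbitrary choice, so computing the gradient of e^(2\<rho>\<psi>)u rests on a.e. uniqueness of weak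
  derivatives, that is, on the fundamental lemma of the calculus of variations. Membership in
  \<open>test_functions\<close> controls the gradient of \<psi> only through \<open>C\<close>; its
  Euclidean size, bounded because \<psi> has compact support, enters with the factor \<epsilon> and
  vanishes in the limit. The supremum in \<open>d_C\<close> need not be attained, so the distance
  itself is reached by a last limit in D, which treats infinite distance as well.\<close>

lemma borel_measurable_cnj [measurable]:
  "f \<in> borel_measurable M \<Longrightarrow> (\<lambda>x. cnj (f x)) \<in> borel_measurable M"
  by (rule measurable_compose[OF _ borel_measurable_continuous_onI]) (auto intro: continuous_intros)

lemma L2_iff:
  "f \<in> L2 \<longleftrightarrow> f \<in> borel_measurable lebesgue \<and> integrable lebesgue (\<lambda>x. (cmod (f x))\<^sup>2)"
  by (simp add: L2_def)

lemma L2_measurable [measurable_dest]: "f \<in> L2 \<Longrightarrow> f \<in> borel_measurable lebesgue"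
  by (simp add: L2_def)

lemma L2_norm_nonneg [simp]: "0 \<le> L2_norm f"
  by (simp add: L2_norm_def)

lemma L2_norm_power2: "(L2_norm f)\<^sup>2 = (LINT x|lebesgue. (cmod (f x))\<^sup>2)"
  by (simp add: L2_norm_def)

lemma L2_norm_le: "0 \<le> b \<Longrightarrow> (LINT x|lebesgue. (cmod (f x))\<^sup>2) \<le> b\<^sup>2 \<Longrightarrow> L2_norm f \<le> b"
  by (simp add: L2_norm_def real_le_lsqrt)

lemma L2_norm_cong:
  assumes "f \<in> L2" "g \<in> L2" "AE x in lebesgue. f x = g x"
  shows "L2_norm f = L2_norm g"
  unfolding L2_norm_def using assms
  by (intro arg_cong[where f=sqrt] integral_cong_AE) (auto simp: L2_iff)

lemma L2_zero [simp]: "(\<lambda>x. 0) \<in> L2"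
  by (simp add: L2_iff)

lemma L2_norm_zero [simp]: "L2_norm (\<lambda>x. 0) = 0"
  by (simp add: L2_norm_def)

lemma L2_dominated:
  assumes "f \<in> L2" "g \<in> borel_measurable lebesgue" "AE x in lebesgue. cmod (g x) \<le> B * cmod (f x)"
  shows "g \<in> L2" "0 \<le> B \<Longrightarrow> L2_norm g \<le> B * L2_norm f"
proof -
  have dom: "AE x in lebesgue. (cmod (g x))\<^sup>2 \<le> B\<^sup>2 * (cmod (f x))\<^sup>2"
    using assms(3)
  proof eventually_elim
    case (elim x)
    then have "(cmod (g x))\<^sup>2 \<le> (B * cmod (f x))\<^sup>2" by (intro power_mono) auto
    then show ?case by (simp add: power_mult_distrib)
  qed
  have intf: "integrable lebesgue (\<lambda>x. B\<^sup>2 * (cmod (f x))\<^sup>2)" using assms(1) by (simp add: L2_iff)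
  have intg: "integrable lebesgue (\<lambda>x. (cmod (g x))\<^sup>2)"
    by (rule Bochner_Integration.integrable_bound[OF intf]) (use assms(2) dom in auto)
  then show "g \<in> L2" using assms(2) by (simp add: L2_iff)
  assume "0 \<le> B"
  have "(LINT x|lebesgue. (cmod (g x))\<^sup>2) \<le> (LINT x|lebesgue. B\<^sup>2 * (cmod (f x))\<^sup>2)"
    by (rule integral_mono_AE[OF intg intf dom])
  also have "\<dots> = (B * L2_norm f)\<^sup>2"
    by (simp add: power_mult_distrib L2_norm_power2)
  finally show "L2_norm g \<le> B * L2_norm f" using \<open>0 \<le> B\<close> by (intro L2_norm_le) auto
qed

lemma L2_mult_bounded:
  assumes "f \<in> L2" "m \<in> borel_measurable lebesgue" "AE x in lebesgue. cmod (m x) \<le> B"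
  shows "(\<lambda>x. m x * f x) \<in> L2"
  by (rule L2_dominated(1)[OF assms(1), where B = B])
    (use assms in \<open>auto simp: norm_mult intro!: mult_right_mono\<close>)

lemma L2_norm_mult_bounded:
  assumes "f \<in> L2" "m \<in> borel_measurable lebesgue" "AE x in lebesgue. cmod (m x) \<le> B" "0 \<le> B"
  shows "L2_norm (\<lambda>x. m x * f x) \<le> B * L2_norm f"
  by (rule L2_dominated(2)[OF assms(1)])
    (use assms in \<open>auto simp: norm_mult intro!: mult_right_mono\<close>)

lemma L2_cmult: "f \<in> L2 \<Longrightarrow> (\<lambda>x. c * f x) \<in> L2"
  by (rule L2_mult_bounded[where B = "cmod c"]) auto

lemma L2_norm_cmult: "L2_norm (\<lambda>x. c * f x) = cmod c * L2_norm f"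
  by (simp add: L2_norm_def norm_mult power_mult_distrib real_sqrt_mult)

lemma L2_divide: "f \<in> L2 \<Longrightarrow> (\<lambda>x. f x / c) \<in> L2"
  using L2_cmult[of f "inverse c"] by (simp add: divide_inverse mult.commute)

section \<open>Cauchy-Schwarz and triangle inequalities\<close>

lemma L2_integrable_norm_mult:
  assumes "f \<in> L2" "g \<in> L2"
  shows "integrable lebesgue (\<lambda>x. cmod (f x) * cmod (g x))"
proof (rule Bochner_Integration.integrable_bound)
  show "integrable lebesgue (\<lambda>x. (cmod (f x))\<^sup>2 + (cmod (g x))\<^sup>2)"
    using assms by (auto simp: L2_iff)
  show "(\<lambda>x. cmod (f x) * cmod (g x)) \<in> borel_measurable lebesgue"
    using assms by (auto dest!: L2_measurable)
  have "a * b \<le> a\<^sup>2 + b\<^sup>2" if "0 \<le> a" "0 \<le> b" for a b :: real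
    using that sum_squares_bound[of a b] mult_nonneg_nonneg[OF that] by linarith
  then show "AE x in lebesgue. norm (cmod (f x) * cmod (g x)) \<le> norm ((cmod (f x))\<^sup>2 + (cmod (g x))\<^sup>2)"
    by auto
qed

lemma L2_integrable_mult:
  assumes "f \<in> L2" "g \<in> L2"
  shows "integrable lebesgue (\<lambda>x. f x * g x)" "integrable lebesgue (\<lambda>x. cnj (f x) * g x)"
  using assms
  by (auto intro!: Bochner_Integration.integrable_bound[OF L2_integrable_norm_mult[OF assms]]
      simp: norm_mult L2_iff)

text \<open>Young's inequality with the weights b/a and a/b, which make the two integrated squares
  equal, so that their mean is exactly ab. If a norm vanishes, so does the product almost
  everywhere.\<close>

lemma L2_Cauchy_Schwarz_norm:
  assumes "f \<in> L2" "g \<in> L2"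
  shows "(LINT x|lebesgue. cmod (f x) * cmod (g x)) \<le> L2_norm f * L2_norm g"
proof -
  define a b where "a = L2_norm f" and "b = L2_norm g"
  have I: "integrable lebesgue (\<lambda>x. (cmod (f x))\<^sup>2)" "integrable lebesgue (\<lambda>x. (cmod (g x))\<^sup>2)"
    using assms by (auto simp: L2_iff)
  show ?thesis
  proof (cases "a = 0 \<or> b = 0")
    case True
    have "AE x in lebesgue. cmod (f x) * cmod (g x) = 0"
    proof (rule disjE[OF True])
      assume "a = 0"
      then have "(LINT x|lebesgue. (cmod (f x))\<^sup>2) = 0" by (simp add: a_def L2_norm_def)
      then have "AE x in lebesgue. (cmod (f x))\<^sup>2 = 0"
        using integral_nonneg_eq_0_iff_AE[OF I(1)] by simp
      then show ?thesis by eventually_elim auto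
    next
      assume "b = 0"
      then have "(LINT x|lebesgue. (cmod (g x))\<^sup>2) = 0" by (simp add: b_def L2_norm_def)
      then have "AE x in lebesgue. (cmod (g x))\<^sup>2 = 0"
        using integral_nonneg_eq_0_iff_AE[OF I(2)] by simp
      then show ?thesis by eventually_elim auto
    qed
    then have "(LINT x|lebesgue. cmod (f x) * cmod (g x)) = 0" by (rule integral_eq_zero_AE)
    then show ?thesis by simp
  next
    case False
    then have ab: "a > 0" "b > 0"
      by (auto simp: a_def b_def less_le)
    have "(LINT x|lebesgue. cmod (f x) * cmod (g x))
        \<le> (LINT x|lebesgue. (b / a * (cmod (f x))\<^sup>2 + a / b * (cmod (g x))\<^sup>2) / 2)"
    proof (rule integral_mono[OF L2_integrable_norm_mult[OF assms]])
      show "integrable lebesgue (\<lambda>x. (b / a * (cmod (f x))\<^sup>2 + a / b * (cmod (g x))\<^sup>2) / 2)"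
        using I by auto
      fix x
      have "0 \<le> (b * cmod (f x) - a * cmod (g x))\<^sup>2 / (2 * a * b)" using ab by simp
      also have "\<dots> = (b / a * (cmod (f x))\<^sup>2 + a / b * (cmod (g x))\<^sup>2) / 2 - cmod (f x) * cmod (g x)"
        using ab by (simp add: field_simps power2_eq_square)
      finally show "cmod (f x) * cmod (g x) \<le> (b / a * (cmod (f x))\<^sup>2 + a / b * (cmod (g x))\<^sup>2) / 2"
        by simp
    qed
    also have "\<dots> = (b / a * a\<^sup>2 + a / b * b\<^sup>2) / 2"
      using I by (simp add: a_def b_def L2_norm_power2)
    also have "\<dots> = a * b" using ab by (simp add: power2_eq_square)
    finally show ?thesis by (simp add: a_def b_def)
  qed
qed

lemma L2_Cauchy_Schwarz:
  assumes "f \<in> L2" "g \<in> L2"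
  shows "cmod (L2_inner f g) \<le> L2_norm f * L2_norm g"
proof -
  have "cmod (L2_inner f g) \<le> (LINT x|lebesgue. cmod (cnj (f x) * g x))"
    unfolding L2_inner_def by (rule integral_norm_bound)
  then show ?thesis using L2_Cauchy_Schwarz_norm[OF assms] by (simp add: norm_mult)
qed

lemma L2_add:
  assumes "f \<in> L2" "g \<in> L2"
  shows "(\<lambda>x. f x + g x) \<in> L2" "L2_norm (\<lambda>x. f x + g x) \<le> L2_norm f + L2_norm g"
proof -
  let ?B = "\<lambda>x. (cmod (f x))\<^sup>2 + 2 * (cmod (f x) * cmod (g x)) + (cmod (g x))\<^sup>2"
  have I: "integrable lebesgue (\<lambda>x. (cmod (f x))\<^sup>2)" "integrable lebesgue (\<lambda>x. (cmod (g x))\<^sup>2)"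
    using assms by (auto simp: L2_iff)
  note J = L2_integrable_norm_mult[OF assms]
  have le: "(cmod (f x + g x))\<^sup>2 \<le> ?B x" for x
  proof -
    have "(cmod (f x + g x))\<^sup>2 \<le> (cmod (f x) + cmod (g x))\<^sup>2"
      by (intro power_mono norm_triangle_ineq) auto
    then show ?thesis by (simp add: power2_sum)
  qed
  have IB: "integrable lebesgue ?B" using I J by auto
  have int: "integrable lebesgue (\<lambda>x. (cmod (f x + g x))\<^sup>2)"
  proof (rule Bochner_Integration.integrable_bound[OF IB])
    show "(\<lambda>x. (cmod (f x + g x))\<^sup>2) \<in> borel_measurable lebesgue"
      using assms by (auto dest!: L2_measurable)
  qed (use le in \<open>auto simp: abs_of_nonneg\<close>)
  then show "(\<lambda>x. f x + g x) \<in> L2" using assms by (auto simp: L2_iff)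
  have "(LINT x|lebesgue. (cmod (f x + g x))\<^sup>2) \<le> (LINT x|lebesgue. ?B x)"
    by (rule integral_mono[OF int IB le])
  also have "\<dots> = (L2_norm f)\<^sup>2 + 2 * (LINT x|lebesgue. cmod (f x) * cmod (g x)) + (L2_norm g)\<^sup>2"
    using I J by (simp add: L2_norm_power2)
  also have "\<dots> \<le> (L2_norm f + L2_norm g)\<^sup>2"
    using L2_Cauchy_Schwarz_norm[OF assms] by (simp add: power2_sum)
  finally show "L2_norm (\<lambda>x. f x + g x) \<le> L2_norm f + L2_norm g"
    by (intro L2_norm_le) auto
qed

lemma L2_diff:
  assumes "f \<in> L2" "g \<in> L2"
  shows "(\<lambda>x. f x - g x) \<in> L2" "L2_norm (\<lambda>x. f x - g x) \<le> L2_norm f + L2_norm g"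
  using L2_add[OF assms(1) L2_cmult[OF assms(2), of "-1"]] L2_norm_cmult[of "-1" g]
  by auto

lemma L2_norm_minus_commute: "L2_norm (\<lambda>x. f x - g x) = L2_norm (\<lambda>x. g x - f x)"
  by (simp add: L2_norm_def norm_minus_commute)

lemma L2_norm_le_add_diff:
  assumes "f \<in> L2" "g \<in> L2"
  shows "L2_norm f \<le> L2_norm g + L2_norm (\<lambda>x. f x - g x)"
  using L2_add(2)[OF assms(2) L2_diff(1)[OF assms]] by simp

lemma L2_norm_abs_diff:
  assumes "f \<in> L2" "g \<in> L2"
  shows "\<bar>L2_norm f - L2_norm g\<bar> \<le> L2_norm (\<lambda>x. f x - g x)"
  using L2_norm_le_add_diff[OF assms] L2_norm_le_add_diff[OF assms(2,1)]
    L2_norm_minus_commute[of f g] by linarith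

lemma L2_sum:
  assumes "finite I" "\<And>i. i \<in> I \<Longrightarrow> f i \<in> L2"
  shows "(\<lambda>x. \<Sum>i\<in>I. f i x) \<in> L2 \<and> L2_norm (\<lambda>x. \<Sum>i\<in>I. f i x) \<le> (\<Sum>i\<in>I. L2_norm (f i))"
  using assms
proof (induction I rule: finite_induct)
  case (insert i I)
  then have "(\<lambda>x. \<Sum>i\<in>I. f i x) \<in> L2" by blast
  from L2_add[OF _ this, of "f i"] insert show ?case
    by (auto intro: order_trans)
qed simp

text \<open>The function \<open>\<Sum>n. 2\<^sup>n |g\<^sub>n|\<^sup>2\<close> is integrable, which forces pointwise convergence of the series;
  the norm estimate then follows from Fatou's lemma.\<close>

lemma L2_geometric_series:
  fixes g :: "nat \<Rightarrow> real^'n \<Rightarrow> complex"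
  assumes g: "\<And>n. g n \<in> L2" and le: "\<And>n. L2_norm (g n) \<le> (1/3) ^ n"
  obtains s where "s \<in> L2" "\<And>n. L2_norm (\<lambda>x. s x - (\<Sum>k<n. g k x)) \<le> (3/2) * (1/3) ^ n"
proof -
  have gm [measurable]: "g n \<in> borel_measurable lebesgue" for n using g by (auto dest: L2_measurable)
  have nn: "(\<integral>\<^sup>+x. ennreal ((cmod (f x))\<^sup>2) \<partial>lebesgue) = ennreal ((L2_norm f)\<^sup>2)" if "f \<in> L2" for f :: "real^'n \<Rightarrow> complex"
    unfolding L2_norm_power2 using that by (intro nn_integral_eq_integral) (auto simp: L2_iff)
  have "(\<integral>\<^sup>+x. (\<Sum>n. ennreal (2^n * (cmod (g n x))\<^sup>2)) \<partial>lebesgue)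
      = (\<Sum>n. \<integral>\<^sup>+x. ennreal (2^n * (cmod (g n x))\<^sup>2) \<partial>lebesgue)"
    by (rule nn_integral_suminf) measurable
  also have "\<dots> = (\<Sum>n. ennreal (2^n * (L2_norm (g n))\<^sup>2))"
    by (simp add: ennreal_mult' nn_integral_cmult nn[OF g])
  also have "\<dots> \<le> (\<Sum>n. ennreal ((2/9)^n))"
  proof (intro suminf_le ennreal_leI)
    fix n
    have "2^n * (L2_norm (g n))\<^sup>2 \<le> 2^n * ((1/3)^n)\<^sup>2"
      by (intro mult_left_mono power_mono le) auto
    also have "\<dots> = (2/9)^n"
      by (simp add: power2_eq_square flip: power_mult_distrib)
    finally show "2^n * (L2_norm (g n))\<^sup>2 \<le> (2/9)^n" .
  qed auto
  also have "\<dots> = ennreal (\<Sum>n. (2/9)^n)"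
    by (rule suminf_ennreal2) (auto intro: summable_geometric)
  also have "\<dots> < \<infinity>" by simp
  finally have fin: "(\<integral>\<^sup>+x. (\<Sum>n. ennreal (2^n * (cmod (g n x))\<^sup>2)) \<partial>lebesgue) \<noteq> \<infinity>" by simp
  have "AE x in lebesgue. (\<Sum>n. ennreal (2^n * (cmod (g n x))\<^sup>2)) \<noteq> \<infinity>"
    by (rule nn_integral_noteq_infinite[OF _ fin]) measurable
  then have conv: "AE x in lebesgue. summable (\<lambda>n. g n x)"
  proof eventually_elim
    case (elim x)
    then have "summable (\<lambda>n. 2^n * (cmod (g n x))\<^sup>2)"
      by (intro summable_suminf_not_top) auto
    then have "Bseq (\<lambda>n. 2^n * (cmod (g n x))\<^sup>2)"
      by (intro convergent_imp_Bseq) (auto simp: convergent_def dest: summable_LIMSEQ_zero)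
    then obtain K where K: "K > 0" "\<And>n. 2^n * (cmod (g n x))\<^sup>2 \<le> K"
      by (auto simp: Bseq_def abs_mult)
    \<comment> \<open>Boundedness of the terms weighted by 2^n already gives |g_n(x)| \<le> sqrt K *
      2^(-n/2), a geometric majorant.\<close>
    have "summable (\<lambda>n. sqrt K * (1 / sqrt 2) ^ n)"
      by (intro summable_mult summable_geometric) (simp add: real_less_rsqrt)
    moreover have "norm (g n x) \<le> sqrt K * (1 / sqrt 2) ^ n" for n
    proof -
      have "(cmod (g n x))\<^sup>2 \<le> K / 2^n" using K(2)[of n] by (simp add: field_simps)
      then have "cmod (g n x) \<le> sqrt (K / 2^n)" by (rule real_le_rsqrt)
      then show ?thesis by (simp add: real_sqrt_divide real_sqrt_power power_divide)
    qed
    ultimately show ?case by (rule summable_comparison_test'[where N=0])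
  qed
  define s where "s = (\<lambda>x. \<Sum>n. g n x)"
  have sm [measurable]: "s \<in> borel_measurable lebesgue" unfolding s_def by measurable
  define P where "P = (\<lambda>n x. \<Sum>k<n. g k x)"
  have PL: "P n \<in> L2" for n unfolding P_def using L2_sum[of "{..<n}" g] g by auto
  have Pm [measurable]: "P n \<in> borel_measurable lebesgue" for n using PL by (auto dest: L2_measurable)
  have bound: "(\<integral>\<^sup>+x. ennreal ((cmod (s x - P n x))\<^sup>2) \<partial>lebesgue) \<le> ennreal (((3/2) * (1/3) ^ n)\<^sup>2)" for n
  proof -
    have "(\<integral>\<^sup>+x. ennreal ((cmod (s x - P n x))\<^sup>2) \<partial>lebesgue)
       = (\<integral>\<^sup>+x. liminf (\<lambda>m. ennreal ((cmod (P m x - P n x))\<^sup>2)) \<partial>lebesgue)"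
    proof (rule nn_integral_cong_AE)
      show "AE x in lebesgue. ennreal ((cmod (s x - P n x))\<^sup>2)
              = liminf (\<lambda>m. ennreal ((cmod (P m x - P n x))\<^sup>2))"
        using conv
      proof eventually_elim
        case (elim x)
        then have "(\<lambda>m. P m x) \<longlonglongrightarrow> s x" unfolding P_def s_def by (rule summable_LIMSEQ)
        then have "(\<lambda>m. ennreal ((cmod (P m x - P n x))\<^sup>2)) \<longlonglongrightarrow> ennreal ((cmod (s x - P n x))\<^sup>2)"
          by (intro tendsto_intros tendsto_ennrealI)
        then show ?case by (intro lim_imp_Liminf[symmetric]) auto
      qed
    qed
    also have "\<dots> \<le> liminf (\<lambda>m. \<integral>\<^sup>+x. ennreal ((cmod (P m x - P n x))\<^sup>2) \<partial>lebesgue)"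
      by (rule nn_integral_liminf) measurable
    also have "\<dots> \<le> liminf (\<lambda>m. ennreal (((3/2) * (1/3) ^ n)\<^sup>2))"
    proof (rule Liminf_mono)
      show "\<forall>\<^sub>F m in sequentially. (\<integral>\<^sup>+x. ennreal ((cmod (P m x - P n x))\<^sup>2) \<partial>lebesgue)
              \<le> ennreal (((3/2) * (1/3) ^ n)\<^sup>2)"
        using eventually_ge_at_top[of n]
      proof eventually_elim
        case (elim m)
        have eq: "P m x - P n x = (\<Sum>k\<in>{n..<m}. g k x)" for x
        proof -
          have "{..<m} = {..<n} \<union> {n..<m}" using elim by auto
          then show ?thesis unfolding P_def by (simp add: sum.union_disjoint ivl_disj_int)
        qed
        have "L2_norm (\<lambda>x. P m x - P n x) \<le> (\<Sum>k\<in>{n..<m}. L2_norm (g k))"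
          unfolding eq using L2_sum[of "{n..<m}" g] g by auto
        also have "\<dots> \<le> (\<Sum>k\<in>{n..<m}. (1/3)^k)" by (intro sum_mono le)
        \<comment> \<open>The constant is 1/(1 - 1/3). The bound is uniform in m, so it passes to
          the liminf.\<close>
        also have "\<dots> \<le> (3/2) * (1/3) ^ n"
        proof -
          have "(\<Sum>k\<in>{n..<m}. (1/3::real)^k) = (3/2) * ((1/3)^n - (1/3)^m)"
            using elim
          proof (induction m rule: dec_induct)
            case (step m)
            have "(1/3::real) ^ Suc m = (1/3)^m / 3" by simp
            then show ?case using step by (simp del: power_Suc power_one_over)
          qed simp
          moreover have "0 \<le> (1/3::real)^m" by simp
          ultimately show ?thesis by (simp only: right_diff_distrib)
        qed
        finally have "(L2_norm (\<lambda>x. P m x - P n x))\<^sup>2 \<le> ((3/2) * (1/3) ^ n)\<^sup>2"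
          by (intro power_mono) auto
        then show ?case unfolding nn[OF L2_diff(1)[OF PL PL]] by (rule ennreal_leI)
      qed
    qed
    finally show ?thesis by (simp add: Liminf_const)
  qed
  have sP: "(\<lambda>x. s x - P n x) \<in> L2" for n
  proof -
    have "integrable lebesgue (\<lambda>x. (cmod (s x - P n x))\<^sup>2)"
      by (rule integrableI_bounded) (auto intro: le_less_trans[OF bound])
    then show ?thesis by (auto simp: L2_iff)
  qed
  show thesis
  proof
    show "s \<in> L2" using sP[of 0] by (simp add: P_def)
    fix n
    have "ennreal ((L2_norm (\<lambda>x. s x - P n x))\<^sup>2) \<le> ennreal (((3/2) * (1/3) ^ n)\<^sup>2)"
      using bound[of n] unfolding nn[OF sP] .
    then have "(L2_norm (\<lambda>x. s x - P n x))\<^sup>2 \<le> ((3/2) * (1/3) ^ n)\<^sup>2"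
      by (subst (asm) ennreal_le_iff) auto
    then show "L2_norm (\<lambda>x. s x - (\<Sum>k<n. g k x)) \<le> (3/2) * (1/3) ^ n"
      unfolding P_def by (rule power2_le_imp_le) auto
  qed
qed

section \<open>Bounded operators and uniform boundedness\<close>

lemma bounded_L2_operator_L2: "bounded_L2_operator T \<Longrightarrow> f \<in> L2 \<Longrightarrow> T f \<in> L2"
  by (simp add: bounded_L2_operator_def)

lemma bounded_L2_operator_linear:
  "bounded_L2_operator T \<Longrightarrow> f \<in> L2 \<Longrightarrow> g \<in> L2 \<Longrightarrow>
    AE x in lebesgue. T (\<lambda>y. a * f y + b * g y) x = a * T f x + b * T g x"
  by (simp add: bounded_L2_operator_def)

lemma bounded_L2_operator_bound:
  assumes "bounded_L2_operator T"
  obtains M where "M \<ge> 0" "\<And>f. f \<in> L2 \<Longrightarrow> L2_norm (T f) \<le> M * L2_norm f"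
proof -
  from assms obtain M where M: "\<forall>f\<in>L2. L2_norm (T f) \<le> M * L2_norm f"
    by (auto simp: bounded_L2_operator_def)
  have "L2_norm (T f) \<le> \<bar>M\<bar> * L2_norm f" if "f \<in> L2" for f
    using M that mult_right_mono[of M "\<bar>M\<bar>" "L2_norm f"] by (force intro: order_trans)
  then show thesis by (intro that[of "\<bar>M\<bar>"]) auto
qed

lemma bounded_L2_operator_cmult:
  "bounded_L2_operator T \<Longrightarrow> f \<in> L2 \<Longrightarrow> AE x in lebesgue. T (\<lambda>y. a * f y) x = a * T f x"
  using bounded_L2_operator_linear[of T f f a 0] by simp

lemma bounded_L2_operator_diff:
  "bounded_L2_operator T \<Longrightarrow> f \<in> L2 \<Longrightarrow> g \<in> L2 \<Longrightarrow>
    AE x in lebesgue. T (\<lambda>y. f y - g y) x = T f x - T g x"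
  using bounded_L2_operator_linear[of T f g 1 "-1"] by simp

lemma bounded_L2_operator_norm_diff:
  assumes "bounded_L2_operator T" "f \<in> L2" "g \<in> L2"
  shows "L2_norm (\<lambda>x. T f x - T g x) = L2_norm (T (\<lambda>y. f y - g y))"
proof (rule L2_norm_cong)
  show "AE x in lebesgue. T f x - T g x = T (\<lambda>y. f y - g y) x"
    using bounded_L2_operator_diff[OF assms] by eventually_elim simp
qed (use assms in \<open>simp_all add: L2_diff(1) bounded_L2_operator_L2\<close>)

text \<open>The operator norm s, a supremum over the unit ball, need not be attained, but s > c
  \<ge> 0 makes max(c, 2s/3) strictly smaller than s, so some y in the ball exceeds it. The factor
  3/2 is the inverse of 2/3.\<close>

lemma bounded_L2_operator_almost_norming:
  assumes T: "bounded_L2_operator T" and c: "0 \<le> c" and unb: "\<not> (\<forall>f\<in>L2. L2_norm (T f) \<le> c * L2_norm f)"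
  obtains y where "y \<in> L2" "L2_norm y \<le> 1" "c < L2_norm (T y)"
    "\<And>g. g \<in> L2 \<Longrightarrow> L2_norm (T g) \<le> 3/2 * L2_norm (T y) * L2_norm g"
proof -
  obtain M where M: "M \<ge> 0" "\<And>f. f \<in> L2 \<Longrightarrow> L2_norm (T f) \<le> M * L2_norm f"
    using bounded_L2_operator_bound[OF T] by blast
  define A where "A = (\<lambda>y. L2_norm (T y)) ` {y \<in> L2. L2_norm y \<le> 1}"
  have ne: "A \<noteq> {}" using L2_zero L2_norm_zero unfolding A_def by (auto intro!: exI[of _ "\<lambda>x. 0"])
  have bdd: "bdd_above A"
  proof (rule bdd_aboveI)
    fix a assume "a \<in> A"
    then obtain y where y: "y \<in> L2" "L2_norm y \<le> 1" "a = L2_norm (T y)" by (auto simp: A_def)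
    then have "a \<le> M * L2_norm y" using M by simp
    also have "\<dots> \<le> M" using mult_left_mono[OF y(2) M(1)] by simp
    finally show "a \<le> M" .
  qed
  define s where "s = Sup A"
  have le_s: "L2_norm (T g) \<le> s * L2_norm g" if g: "g \<in> L2" for g
  proof (cases "L2_norm g = 0")
    case True
    then show ?thesis using M(2)[OF g] by simp
  next
    case False
    define a where "a = complex_of_real (inverse (L2_norm g))"
    have n: "cmod a * L2_norm g = 1" using False by (simp add: a_def norm_inverse)
    have "L2_norm (T (\<lambda>x. a * g x)) \<in> A"
      unfolding A_def using g n by (intro imageI) (auto simp: L2_cmult L2_norm_cmult)
    then have "L2_norm (T (\<lambda>x. a * g x)) \<le> s" unfolding s_def by (rule cSup_upper[OF _ bdd])
    moreover have "L2_norm (T (\<lambda>x. a * g x)) = L2_norm (\<lambda>x. a * T g x)"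
      by (intro L2_norm_cong bounded_L2_operator_cmult bounded_L2_operator_L2[OF T] L2_cmult T g)
    ultimately have "cmod a * L2_norm (T g) \<le> s" by (simp add: L2_norm_cmult)
    then have "cmod a * L2_norm (T g) * L2_norm g \<le> s * L2_norm g" by (intro mult_right_mono) auto
    moreover have "cmod a * L2_norm (T g) * L2_norm g = (cmod a * L2_norm g) * L2_norm (T g)" by simp
    ultimately show ?thesis unfolding n by simp
  qed
  from unb obtain g where g: "g \<in> L2" "c * L2_norm g < L2_norm (T g)" by (auto simp: not_le)
  have "c < s"
  proof (rule ccontr)
    assume "\<not> c < s"
    then have "s * L2_norm g \<le> c * L2_norm g" by (intro mult_right_mono) auto
    then show False using g(2) le_s[OF g(1)] by simp
  qed
  then have "max c (2/3 * s) < s" using c by auto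
  then obtain a where "a \<in> A" "max c (2/3 * s) < a"
    using less_cSup_iff[OF ne bdd] s_def by blast
  then obtain y where y: "y \<in> L2" "L2_norm y \<le> 1" "max c (2/3 * s) < L2_norm (T y)"
    unfolding A_def by blast
  show thesis
  proof (rule that[OF y(1,2)])
    fix g :: "real^'a \<Rightarrow> complex" assume g: "g \<in> L2"
    have "s * L2_norm g \<le> 3/2 * L2_norm (T y) * L2_norm g"
      using y(3) by (intro mult_right_mono) auto
    then show "L2_norm (T g) \<le> 3/2 * L2_norm (T y) * L2_norm g" using le_s[OF g] by simp
  qed (use y in auto)
qed

text \<open>Sokal's proof of the uniform boundedness principle: if the norms are unbounded, one adds
  \<open>\<plusminus>3\<^sup>-\<^sup>n y\<^sub>n\<close> successively, with \<open>y\<^sub>n\<close> almost norming for an operator of norm above \<open>4\<^sup>n\<close> and the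
  sign chosen such that the image does not cancel.\<close>

lemma uniform_boundedness:
  fixes T :: "'i \<Rightarrow> (real^'n \<Rightarrow> complex) \<Rightarrow> (real^'n \<Rightarrow> complex)"
  assumes T: "\<And>i. i \<in> I \<Longrightarrow> bounded_L2_operator (T i)"
    and pw: "\<And>f. f \<in> L2 \<Longrightarrow> \<exists>B. \<forall>i\<in>I. L2_norm (T i f) \<le> B"
  obtains M where "\<And>i f. i \<in> I \<Longrightarrow> f \<in> L2 \<Longrightarrow> L2_norm (T i f) \<le> M * L2_norm f"
proof (rule ccontr)
  assume "\<not> thesis"
  then have unb: "\<exists>i\<in>I. \<not> (\<forall>f\<in>L2. L2_norm (T i f) \<le> M * L2_norm f)" for M
    using that by blast
  have "\<exists>i y. i \<in> I \<and> y \<in> L2 \<and> L2_norm y \<le> 1 \<and> 4 ^ n < L2_norm (T i y) \<and>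
      (\<forall>g\<in>L2. L2_norm (T i g) \<le> 3/2 * L2_norm (T i y) * L2_norm g)" for n :: nat
  proof -
    obtain i where i: "i \<in> I" "\<not> (\<forall>f\<in>L2. L2_norm (T i f) \<le> 4 ^ n * L2_norm f)"
      using unb by blast
    from bounded_L2_operator_almost_norming[OF T[OF i(1)] _ i(2)] show ?thesis
      using i(1) by (metis zero_le_numeral zero_le_power)
  qed
  then obtain i y where iy: "\<And>n. i n \<in> I" "\<And>n. y n \<in> L2" "\<And>n. L2_norm (y n) \<le> 1"
      "\<And>n. 4 ^ n < L2_norm (T (i n) (y n))"
      "\<And>n g. g \<in> L2 \<Longrightarrow> L2_norm (T (i n) g) \<le> 3/2 * L2_norm (T (i n) (y n)) * L2_norm g"
    by metis
  let ?P = "\<lambda>(n::nat) (x :: real^'n \<Rightarrow> complex). x \<in> L2"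
  let ?Q = "\<lambda>(n::nat) x x'. L2_norm (\<lambda>z. x' z - x z) \<le> (1/3)^n \<and>
              (1/3)^n * L2_norm (T (i n) (y n)) \<le> L2_norm (T (i n) x')"
  have "\<exists>x. \<forall>n. ?P n (x n) \<and> ?Q n (x n) (x (Suc n))"
  proof (rule dependent_nat_choice)
    show "\<exists>x. ?P 0 x" using L2_zero by blast
    fix x :: "real^'n \<Rightarrow> complex" and n assume x: "x \<in> L2"
    note Tn = T[OF iy(1)[of n]]
    define q where "q = complex_of_real ((1/3)^n)"
    have q: "cmod q = (1/3)^n" by (simp add: q_def norm_power norm_divide)
    define x1 where "x1 = (\<lambda>z. x z + q * y n z)"
    define x2 where "x2 = (\<lambda>z. x z - q * y n z)"
    have L: "x1 \<in> L2" "x2 \<in> L2"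
      unfolding x1_def x2_def by (intro L2_add(1) L2_diff(1) L2_cmult x iy(2))+
    have small: "L2_norm (\<lambda>z. q * y n z) \<le> (1/3)^n"
      unfolding L2_norm_cmult q using mult_left_mono[OF iy(3)[of n], of "(1/3)^n"] by simp
    have s1: "L2_norm (\<lambda>z. x1 z - x z) \<le> (1/3)^n" using small by (simp add: x1_def)
    have "L2_norm (\<lambda>z. x2 z - x z) = L2_norm (\<lambda>z. q * y n z)"
      unfolding L2_norm_def x2_def by simp
    then have s2: "L2_norm (\<lambda>z. x2 z - x z) \<le> (1/3)^n" using small by simp
    \<comment> \<open>Since \<open>x1 - x2\<close> is twice the increment, the images of both
      candidates cannot be small: their norms sum to at least twice the norm of the image of the
      increment.\<close>
    have "2 * ((1/3)^n * L2_norm (T (i n) (y n))) = L2_norm (\<lambda>z. 2 * q * T (i n) (y n) z)"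
      by (simp only: L2_norm_cmult norm_mult q) simp
    also have "\<dots> = L2_norm (T (i n) (\<lambda>z. 2 * q * y n z))"
      using bounded_L2_operator_cmult[OF Tn iy(2), of "2 * q" n]
      by (intro L2_norm_cong L2_cmult bounded_L2_operator_L2[OF Tn] iy(2)) auto
    also have "(\<lambda>z. 2 * q * y n z) = (\<lambda>z. x1 z - x2 z)" by (auto simp: x1_def x2_def)
    also have "L2_norm (T (i n) (\<lambda>z. x1 z - x2 z)) = L2_norm (\<lambda>z. T (i n) x1 z - T (i n) x2 z)"
      by (rule bounded_L2_operator_norm_diff[OF Tn L, symmetric])
    also have "\<dots> \<le> L2_norm (T (i n) x1) + L2_norm (T (i n) x2)"
      by (intro L2_diff(2) bounded_L2_operator_L2[OF Tn] L)
    finally have "(1/3)^n * L2_norm (T (i n) (y n)) \<le> L2_norm (T (i n) x1) \<or>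
        (1/3)^n * L2_norm (T (i n) (y n)) \<le> L2_norm (T (i n) x2)" by linarith
    then show "\<exists>x'. ?P (Suc n) x' \<and> ?Q n x x'" using L s1 s2 by blast
  qed
  then obtain x where x: "\<And>n. x n \<in> L2" "\<And>n. L2_norm (\<lambda>z. x (Suc n) z - x n z) \<le> (1/3)^n"
      "\<And>n. (1/3)^n * L2_norm (T (i n) (y n)) \<le> L2_norm (T (i n) (x (Suc n)))"
    by blast
  obtain s where s: "s \<in> L2"
    "\<And>n. L2_norm (\<lambda>z. s z - (\<Sum>k<n. x (Suc k) z - x k z)) \<le> (3/2) * (1/3) ^ n"
    using L2_geometric_series[of "\<lambda>n z. x (Suc n) z - x n z"] x(1,2) by (auto intro: L2_diff)
  \<comment> \<open>The series sums the increments of the sequence \<open>x\<close>, so its limit is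
    recovered by adding the starting point.\<close>
  define r where "r = (\<lambda>z. s z + x 0 z)"
  have rL: "r \<in> L2" unfolding r_def using s(1) x(1) by (rule L2_add)
  have r: "L2_norm (\<lambda>z. r z - x n z) \<le> (3/2) * (1/3) ^ n" for n
  proof -
    have "s z - (\<Sum>k<n. x (Suc k) z - x k z) = r z - x n z" for z
      by (simp only: sum_lessThan_telescope[of "\<lambda>k. x k z"] r_def) simp
    then show ?thesis using s(2)[of n] by simp
  qed
  obtain B where B: "\<And>i. i \<in> I \<Longrightarrow> L2_norm (T i r) \<le> B" using pw[OF rL] by blast
  have "(4/3)^n \<le> 4 * B" for n
  proof -
    note Tn = T[OF iy(1)[of n]]
    define m where "m = L2_norm (T (i n) (y n))"
    have m: "4^n < m" "0 \<le> m" using iy(4)[of n] by (auto simp: m_def)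
    \<comment> \<open>All later increments together have norm at most (3/2)(1/3)^(n+1) =
      (1/2)(1/3)^n. Multiplied by the operator bound (3/2)m, they cancel at most 3/4 of (1/3)^n m,
      and the remaining quarter exceeds (4/3)^n / 4.\<close>
    have "L2_norm (\<lambda>z. x (Suc n) z - r z) \<le> 1/2 * (1/3)^n"
      using r[of "Suc n"] by (simp add: L2_norm_minus_commute)
    then have d: "3/2 * m * L2_norm (\<lambda>z. x (Suc n) z - r z) \<le> 3/2 * m * (1/2 * (1/3)^n)"
      using m(2) by (intro mult_left_mono) auto
    have "(1/3)^n * m \<le> L2_norm (T (i n) (x (Suc n)))" using x(3) by (simp add: m_def)
    also have "\<dots> \<le> L2_norm (T (i n) r) + L2_norm (\<lambda>z. T (i n) (x (Suc n)) z - T (i n) r z)"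
      by (intro L2_norm_le_add_diff bounded_L2_operator_L2[OF Tn] x rL)
    also have "\<dots> \<le> B + 3/2 * m * L2_norm (\<lambda>z. x (Suc n) z - r z)"
      unfolding bounded_L2_operator_norm_diff[OF Tn x(1) rL] m_def
      by (intro add_mono B iy L2_diff x rL)
    also note d
    finally have "(1/3)^n * m \<le> 4 * B" by (simp add: field_simps)
    moreover have "(4/3)^n \<le> (1/3)^n * m"
      using m(1) by (simp add: power_divide field_simps)
    ultimately show ?thesis by linarith
  qed
  moreover obtain n where "4 * B < (4/3)^n" using real_arch_pow[of "4/3" "4 * B"] by auto
  ultimately show False by (meson not_le)
qed

text \<open>Without a bound near 0 there are times s_n tending to 0 at which the operator norm
  exceeds n. Along this sequence \<open>S (s n) g\<close> converges to g for every g, hence is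
  bounded, contradicting uniform boundedness. The semigroup law then spreads the bound from a short
  interval to [0, t].\<close>

lemma semigroup_of_locally_bounded:
  assumes S: "semigroup_of H S"
  obtains M where "1 \<le> M" "\<And>s f. 0 \<le> s \<Longrightarrow> s \<le> t \<Longrightarrow> f \<in> L2 \<Longrightarrow> L2_norm (S s f) \<le> M * L2_norm f"
proof -
  have bd: "\<And>t. 0 \<le> t \<Longrightarrow> bounded_L2_operator (S t)"
    and S0: "\<And>f. f \<in> L2 \<Longrightarrow> AE x in lebesgue. S 0 f x = f x"
    and add: "\<And>s t f. 0 \<le> s \<Longrightarrow> 0 \<le> t \<Longrightarrow> f \<in> L2 \<Longrightarrow> AE x in lebesgue. S (s + t) f x = S s (S t f) x"
    and cont: "\<And>f. f \<in> L2 \<Longrightarrow> ((\<lambda>t. L2_norm (\<lambda>x. S t f x - f x)) \<longlongrightarrow> 0) (at_right 0)"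
    using S unfolding semigroup_of_def by blast+
  have SL: "\<And>t f. 0 \<le> t \<Longrightarrow> f \<in> L2 \<Longrightarrow> S t f \<in> L2"
    by (rule bounded_L2_operator_L2[OF bd])
  have "\<exists>d>0. \<exists>M. \<forall>s\<in>{0<..<d}. \<forall>f\<in>L2. L2_norm (S s f) \<le> M * L2_norm f"
  proof (rule ccontr)
    assume neg: "\<not> ?thesis"
    have "\<exists>s f. 0 < s \<and> s < 1 / real (Suc n) \<and> f \<in> L2 \<and> real n * L2_norm f < L2_norm (S s f)" for n
    proof (rule ccontr)
      assume "\<not> ?thesis"
      then have "\<forall>s\<in>{0<..<1 / real (Suc n)}. \<forall>f\<in>L2. L2_norm (S s f) \<le> real n * L2_norm f"
        by (metis greaterThanLessThan_iff not_less)
      moreover have "0 < 1 / real (Suc n)" by simp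
      ultimately show False using neg by blast
    qed
    then obtain s f where sf: "\<And>n. 0 < s n" "\<And>n. s n < 1 / real (Suc n)" "\<And>n. f n \<in> L2"
        "\<And>n. real n * L2_norm (f n) < L2_norm (S (s n) (f n))" by metis
    have "s \<longlonglongrightarrow> 0"
    proof (rule real_tendsto_sandwich[OF _ _ tendsto_const lim_inverse_n'])
      show "\<forall>\<^sub>F n in sequentially. s n \<le> 1 / real n"
        using eventually_gt_at_top[of 0]
      proof eventually_elim
        case (elim n)
        then have "1 / real (Suc n) \<le> 1 / real n" by (simp add: field_simps)
        then show ?case using sf(2)[of n] by linarith
      qed
    qed (use sf(1) in \<open>auto intro: always_eventually less_imp_le\<close>)
    then have lim: "filterlim s (at_right 0) sequentially"
      using sf(1) by (auto simp: filterlim_at intro!: always_eventually less_imp_neq[symmetric])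
    have "\<exists>M. \<forall>i f. f \<in> L2 \<longrightarrow> L2_norm (S (s i) f) \<le> M * L2_norm f"
    proof (rule uniform_boundedness[where I = UNIV and T = "\<lambda>i. S (s i)"])
      show "bounded_L2_operator (S (s i))" for i by (intro bd less_imp_le sf(1))
      fix g :: "real^'a \<Rightarrow> complex" assume g: "g \<in> L2"
      have "(\<lambda>n. L2_norm (\<lambda>x. S (s n) g x - g x)) \<longlonglongrightarrow> 0"
        by (rule filterlim_compose[OF cont[OF g] lim])
      then have "Bseq (\<lambda>n. L2_norm (\<lambda>x. S (s n) g x - g x))"
        by (intro convergent_imp_Bseq) (auto simp: convergent_def)
      then obtain K where K: "\<And>n. L2_norm (\<lambda>x. S (s n) g x - g x) \<le> K"
        by (auto simp: Bseq_def)
      have "L2_norm (S (s n) g) \<le> L2_norm g + K" for n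
        using L2_norm_le_add_diff[OF bounded_L2_operator_L2[OF bd[OF less_imp_le[OF sf(1)]] g] g, of n] K[of n] by linarith
      then show "\<exists>B. \<forall>i\<in>UNIV. L2_norm (S (s i) g) \<le> B" by blast
    qed blast
    then obtain M where M: "\<And>i f. f \<in> L2 \<Longrightarrow> L2_norm (S (s i) f) \<le> M * L2_norm f" by blast
    obtain n where n: "M < real n" using reals_Archimedean2 by blast
    have "L2_norm (S (s n) (f n)) \<le> M * L2_norm (f n)" by (rule M[OF sf(3)])
    also have "\<dots> \<le> real n * L2_norm (f n)" using n by (intro mult_right_mono) auto
    finally show False using sf(4)[of n] by simp
  qed
  then obtain d M0 where d: "d > 0"
    "\<And>s f. 0 < s \<Longrightarrow> s < d \<Longrightarrow> f \<in> L2 \<Longrightarrow> L2_norm (S s f) \<le> M0 * L2_norm f"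
    by (auto simp: Ball_def)
  \<comment> \<open>The 1 covers time 0, where the operator is the identity, and makes all powers of
    \<open>M\<close> at least 1.\<close>
  define M where "M = max 1 M0"
  have M: "L2_norm (S s f) \<le> M * L2_norm f" if "0 \<le> s" "s < d" "f \<in> L2" for s f
  proof (cases "s = 0")
    case True
    then have "L2_norm (S s f) = L2_norm f"
      using that S0[OF that(3)] SL[of 0 f] by (intro L2_norm_cong) auto
    also have "\<dots> \<le> M * L2_norm f" using mult_right_mono[of 1 M "L2_norm f"] by (simp add: M_def)
    finally show ?thesis .
  next
    case False
    then have "L2_norm (S s f) \<le> M0 * L2_norm f" using that by (intro d) auto
    also have "\<dots> \<le> M * L2_norm f" by (intro mult_right_mono) (auto simp: M_def)
    finally show ?thesis .
  qed
  have iter: "L2_norm (S s f) \<le> M ^ Suc n * L2_norm f" if "0 \<le> s" "s \<le> real (Suc n) * (d/2)" "f \<in> L2" for n s f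
    using that
  proof (induction n arbitrary: s f)
    case 0
    then show ?case using d(1) by (auto intro!: M)
  next
    case (Suc n)
    \<comment> \<open>Steps of length d/2 stay strictly inside the interval where \<open>M\<close>
      applies.\<close>
    define s1 where "s1 = min s (d/2)"
    have s1: "0 \<le> s1" "s1 < d" "0 \<le> s - s1" "s - s1 \<le> real (Suc n) * (d/2)"
      using Suc.prems d(1) by (auto simp: s1_def min_def field_simps)
    have Sf: "S s1 f \<in> L2" using Suc.prems s1 by (intro SL)
    have "L2_norm (S s f) = L2_norm (S (s - s1) (S s1 f))"
      using add[OF s1(3,1) Suc.prems(3)] Suc.prems s1 Sf
      by (intro L2_norm_cong SL) auto
    also have "\<dots> \<le> M ^ Suc n * L2_norm (S s1 f)" by (rule Suc.IH[OF s1(3,4) Sf])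
    also have "\<dots> \<le> M ^ Suc n * (M * L2_norm f)"
      using Suc.prems s1 by (intro mult_left_mono M) (auto simp: M_def)
    finally show ?case by (simp add: mult_ac)
  qed
  obtain n where n: "t / (d/2) \<le> real n" using real_arch_simple by blast
  then have nt: "t \<le> real (Suc n) * (d/2)" using d(1) by (simp add: field_simps)
  show thesis
  proof (rule that)
    show "1 \<le> M ^ Suc n" by (rule one_le_power) (simp add: M_def)
    show "L2_norm (S s f) \<le> M ^ Suc n * L2_norm f" if "0 \<le> s" "s \<le> t" "f \<in> L2" for s f
      using that nt by (intro iter) linarith+
  qed
qed

section \<open>Passing a resolvent bound to the semigroup\<close>

text \<open>The orbit of \<open>f\<close> at multiples of \<open>h\<close> satisfies the implicit Euler scheme for
  \<open>u' = -Hu\<close> up to an error \<open>o(h)\<close> per step, so that a resolvent bound is inherited by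
  the semigroup.\<close>

lemma semigroup_weighted_bound_domain:
  fixes m :: "real^'n \<Rightarrow> complex"
  assumes S: "semigroup_of H S" and \<omega>: "0 \<le> \<omega>" and t: "0 < t"
    and m: "m \<in> borel_measurable lebesgue" "\<And>x. cmod (m x) \<le> B"
    and res: "\<And>l u v. \<omega> < l \<Longrightarrow> (u, v) \<in> H \<Longrightarrow>
      (l - \<omega>) * L2_norm (\<lambda>x. m x * u x) \<le> L2_norm (\<lambda>x. m x * (of_real l * u x + v x))"
    and fg: "(f, g) \<in> H"
  shows "L2_norm (\<lambda>x. m x * S t f x) \<le> exp (\<omega> * t) * L2_norm (\<lambda>x. m x * f x)"
proof -
  have bd: "\<And>t. 0 \<le> t \<Longrightarrow> bounded_L2_operator (S t)"
    and S0: "\<And>f. f \<in> L2 \<Longrightarrow> AE x in lebesgue. S 0 f x = f x"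
    and add: "\<And>s t f. 0 \<le> s \<Longrightarrow> 0 \<le> t \<Longrightarrow> f \<in> L2 \<Longrightarrow> AE x in lebesgue. S (s + t) f x = S s (S t f) x"
    and cont: "\<And>f. f \<in> L2 \<Longrightarrow> ((\<lambda>t. L2_norm (\<lambda>x. S t f x - f x)) \<longlongrightarrow> 0) (at_right 0)"
    using S unfolding semigroup_of_def by blast+
  have H: "H = {(u, v). u \<in> L2 \<and> v \<in> L2 \<and>
            ((\<lambda>t. L2_norm (\<lambda>x. (S t u x - u x) / of_real t + v x)) \<longlongrightarrow> 0) (at_right 0)}"
    using S unfolding semigroup_of_def by blast
  have SL: "\<And>t f. 0 \<le> t \<Longrightarrow> f \<in> L2 \<Longrightarrow> S t f \<in> L2"
    by (rule bounded_L2_operator_L2[OF bd])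
  have f: "f \<in> L2" and g: "g \<in> L2"
    and gen: "((\<lambda>t. L2_norm (\<lambda>x. (S t f x - f x) / of_real t + g x)) \<longlongrightarrow> 0) (at_right 0)"
    using fg H by auto
  define W where "W = (\<lambda>u. L2_norm (\<lambda>x. m x * u x))"
  have B: "0 \<le> B" using m(2)[of undefined] norm_ge_zero order_trans by blast
  have mL: "(\<lambda>x. m x * u x) \<in> L2" if "u \<in> L2" for u
    using L2_mult_bounded[OF that m(1)] m(2) by auto
  have WB: "W u \<le> B * L2_norm u" if "u \<in> L2" for u
    unfolding W_def using L2_norm_mult_bounded[OF that m(1)] m(2) B by auto
  have Wcong: "W u = W v" if "u \<in> L2" "v \<in> L2" "AE x in lebesgue. u x = v x" for u v
    unfolding W_def using that(3) by (intro L2_norm_cong mL that) (auto elim: eventually_mono)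
  have Wadd: "W (\<lambda>x. u x + v x) \<le> W u + W v" if "u \<in> L2" "v \<in> L2" for u v
    using L2_add(2)[OF mL mL] that by (simp add: W_def ring_distribs)
  have Wcmult: "W (\<lambda>x. a * u x) = cmod a * W u" for a u
    by (simp add: W_def mult.left_commute L2_norm_cmult)
  obtain M where M: "1 \<le> M" "\<And>s f. 0 \<le> s \<Longrightarrow> s \<le> t \<Longrightarrow> f \<in> L2 \<Longrightarrow> L2_norm (S s f) \<le> M * L2_norm f"
    using semigroup_of_locally_bounded[OF S] by blast
  \<comment> \<open>The residual of one implicit Euler step started at f: the generator is evaluated
    at the new point \<open>S h f\<close>, hence \<open>S h g\<close> in place of g. It tends to 0
    because both the residual with g and \<open>S h g - g\<close> do.\<close>
  define e where "e = (\<lambda>h x. (S h f x - f x) / of_real h + S h g x)"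
  have eL: "e h \<in> L2" if "0 \<le> h" for h
    unfolding e_def using that by (intro L2_add(1) L2_divide L2_diff(1) SL f g)
  have e_lim: "((\<lambda>h. L2_norm (e h)) \<longlongrightarrow> 0) (at_right 0)"
  proof (rule tendsto_sandwich[OF _ _ tendsto_const])
    show "((\<lambda>h. L2_norm (\<lambda>x. (S h f x - f x) / of_real h + g x) + L2_norm (\<lambda>x. S h g x - g x)) \<longlongrightarrow> 0) (at_right 0)"
      using tendsto_add[OF gen cont[OF g]] by simp
    show "\<forall>\<^sub>F h in at_right 0. L2_norm (e h)
        \<le> L2_norm (\<lambda>x. (S h f x - f x) / of_real h + g x) + L2_norm (\<lambda>x. S h g x - g x)"
      using eventually_at_right_less[of 0]
    proof eventually_elim
      case (elim h)
      then have "0 \<le> h" by simp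
      have "(\<lambda>x. (S h f x - f x) / of_real h + g x) \<in> L2" "(\<lambda>x. S h g x - g x) \<in> L2"
        using \<open>0 \<le> h\<close> by (intro L2_add(1) L2_divide L2_diff(1) SL f g; assumption)+
      from L2_add(2)[OF this] show ?case by (simp add: e_def)
    qed
  qed auto
  \<comment> \<open>\<open>S s\<close> commutes with \<open>S h\<close>, as both orders give time s
    + h, so it maps the difference quotient at f to the one at \<open>S s f\<close>; its boundedness
    preserves the convergence.\<close>
  have dom: "(S s f, S s g) \<in> H" if s: "0 \<le> s" for s
  proof -
    obtain K where K: "K \<ge> 0" "\<And>f. f \<in> L2 \<Longrightarrow> L2_norm (S s f) \<le> K * L2_norm f"
      using bounded_L2_operator_bound[OF bd[OF s]] by blast
    have "((\<lambda>h. L2_norm (\<lambda>x. (S h (S s f) x - S s f x) / of_real h + S s g x)) \<longlongrightarrow> 0) (at_right 0)"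
    proof (rule tendsto_sandwich[OF _ _ tendsto_const])
      show "((\<lambda>h. K * L2_norm (\<lambda>x. (S h f x - f x) / of_real h + g x)) \<longlongrightarrow> 0) (at_right 0)"
        using tendsto_mult_left[OF gen, of K] by simp
      show "\<forall>\<^sub>F h in at_right 0. L2_norm (\<lambda>x. (S h (S s f) x - S s f x) / of_real h + S s g x)
          \<le> K * L2_norm (\<lambda>x. (S h f x - f x) / of_real h + g x)"
        using eventually_at_right_less[of 0]
      proof eventually_elim
        case (elim h)
        then have h: "0 \<le> h" by simp
        let ?a = "inverse (of_real h) :: complex"
        let ?d = "\<lambda>x. S h f x - f x"
        have d: "?d \<in> L2" by (intro L2_diff(1) SL f h)
        have q: "(\<lambda>x. ?d x / of_real h + g x) \<in> L2" by (intro L2_add(1) L2_divide d g)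
        have "AE x in lebesgue. S s (\<lambda>x. ?d x / of_real h + g x) x
            = (S h (S s f) x - S s f x) / of_real h + S s g x"
          using bounded_L2_operator_linear[OF bd[OF s] d g, of ?a 1]
            bounded_L2_operator_diff[OF bd[OF s] SL[OF h f] f] add[OF s h f] add[OF h s f]
          by eventually_elim (simp add: divide_inverse mult.commute add.commute)
        then have "L2_norm (\<lambda>x. (S h (S s f) x - S s f x) / of_real h + S s g x)
            = L2_norm (S s (\<lambda>x. ?d x / of_real h + g x))"
          by (intro L2_norm_cong L2_add(1) L2_divide L2_diff(1) SL f g s h q) (auto elim: eventually_mono)
        then show ?case using K(2)[OF q] by simp
      qed
    qed auto
    then show ?thesis using s f g by (subst H) (auto intro: SL)
  qed
  \<comment> \<open>The resolvent bound with l = 1/h, applied to (1/h) S_(s+h) f + S_(s+h) g = (1/h)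
    S_s f + S_s e_h. The constant \<open>M\<close> makes the error independent of the position s in
    [0, t].\<close>
  have euler: "(1 - \<omega> * h) * W (S (s + h) f) \<le> W (S s f) + h * (B * M * L2_norm (e h))"
    if h: "0 < h" "\<omega> * h < 1" and s: "0 \<le> s" "s \<le> t" for s h
  proof -
    have h0: "0 \<le> h" and sh: "0 \<le> s + h" using h s by auto
    let ?l = "1 / h" and ?a = "of_real (1 / h) :: complex"
    have l: "\<omega> < ?l" using h by (simp add: field_simps)
    have "AE x in lebesgue. S s (e h) x = ?a * S (s + h) f x - ?a * S s f x + S (s + h) g x"
    proof -
      let ?d = "\<lambda>x. S h f x - f x"
      have d: "?d \<in> L2" by (intro L2_diff(1) SL f h0)
      have eq: "e h = (\<lambda>x. ?a * ?d x + 1 * S h g x)" by (simp add: e_def)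
      show ?thesis
        unfolding eq using bounded_L2_operator_linear[OF bd[OF s(1)] d SL[OF h0 g], of ?a 1]
          bounded_L2_operator_diff[OF bd[OF s(1)] SL[OF h0 f] f] add[OF s(1) h0 f] add[OF s(1) h0 g]
      proof eventually_elim
        case (elim x)
        show ?case unfolding elim by (simp add: right_diff_distrib)
      qed
    qed
    then have ae: "AE x in lebesgue. ?a * S (s + h) f x + S (s + h) g x = ?a * S s f x + S s (e h) x"
      by eventually_elim simp
    have "(?l - \<omega>) * W (S (s + h) f) \<le> W (\<lambda>x. ?a * S (s + h) f x + S (s + h) g x)"
      unfolding W_def by (rule res[OF l dom[OF sh]])
    also have "\<dots> = W (\<lambda>x. ?a * S s f x + S s (e h) x)"
      by (rule Wcong[OF _ _ ae]) (intro L2_add(1) L2_cmult SL sh s f g eL h0)+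
    also have "\<dots> \<le> W (\<lambda>x. ?a * S s f x) + W (S s (e h))"
      by (intro Wadd L2_cmult SL s f eL h0)
    also have "\<dots> \<le> ?l * W (S s f) + B * (M * L2_norm (e h))"
    proof (rule add_mono)
      show "W (\<lambda>x. ?a * S s f x) \<le> ?l * W (S s f)" using h0 by (simp only: Wcmult norm_of_real) simp
      have "W (S s (e h)) \<le> B * L2_norm (S s (e h))" by (intro WB SL s eL h0)
      also have "\<dots> \<le> B * (M * L2_norm (e h))" by (intro mult_left_mono M s eL h0 B)
      finally show "W (S s (e h)) \<le> B * (M * L2_norm (e h))" .
    qed
    finally have "h * ((?l - \<omega>) * W (S (s + h) f)) \<le> h * (?l * W (S s f) + B * (M * L2_norm (e h)))"
      using h0 by (rule mult_left_mono)
    then show ?thesis using h(1) by (simp add: algebra_simps)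
  qed
  \<comment> \<open>With the factors kept on the left and lying in [0, 1], each step adds at most
    one further one-step error.\<close>
  have bound: "(1 - \<omega> * h) ^ k * W (S (real k * h) f) \<le> W f + real k * (h * (B * M * L2_norm (e h)))"
    if h: "0 < h" "\<omega> * h < 1" and k: "real k * h \<le> t" for h k
    using k
  proof (induction k)
    case 0
    then show ?case using Wcong[OF SL f S0[OF f]] f by simp
  next
    case (Suc k)
    let ?q = "1 - \<omega> * h"
    have q: "0 \<le> ?q" "?q \<le> 1" using h \<omega> by auto
    have k: "real k * h \<le> t" using Suc.prems h by (simp add: algebra_simps)
    have E: "0 \<le> h * (B * M * L2_norm (e h))" using h B M(1) by auto
    have "?q ^ Suc k * W (S (real (Suc k) * h) f) = ?q ^ k * (?q * W (S (real k * h + h) f))"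
      by (simp add: algebra_simps)
    also have "\<dots> \<le> ?q ^ k * (W (S (real k * h) f) + h * (B * M * L2_norm (e h)))"
      using h k q by (intro mult_left_mono euler) auto
    also have "\<dots> \<le> ?q ^ k * W (S (real k * h) f) + h * (B * M * L2_norm (e h))"
      using mult_right_mono[OF power_le_one[OF q, of k] E] by (simp add: ring_distribs)
    also have "\<dots> \<le> W f + real (Suc k) * (h * (B * M * L2_norm (e h)))"
      using Suc.IH[OF k] by (simp add: ring_distribs)
    finally show ?case .
  qed
  \<comment> \<open>Take n steps of length h = t/n. The errors total t times a quantity tending to
    0, although the number of steps grows. For n > \<omega>t the parameter l = 1/h lies above
    \<omega>, as the resolvent bound demands.\<close>
  have "exp (- \<omega> * t) * W (S t f) \<le> W f + t * (B * M * 0)"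
  proof (rule tendsto_le[OF sequentially_bot])
    have "(\<lambda>n. (1 + (- \<omega> * t) / real n) ^ n) \<longlonglongrightarrow> exp (- \<omega> * t)"
      by (rule tendsto_exp_limit_sequentially)
    then show "(\<lambda>n. (1 + (- \<omega> * t) / real n) ^ n * W (S t f)) \<longlonglongrightarrow> exp (- \<omega> * t) * W (S t f)"
      by (intro tendsto_intros)
    have "filterlim (\<lambda>n. t / real n) (at_right 0) sequentially"
      unfolding filterlim_at
    proof
      show "\<forall>\<^sub>F n in sequentially. t / real n \<in> {0<..} \<and> t / real n \<noteq> 0"
        using eventually_gt_at_top[of 0] by eventually_elim (use t in auto)
      show "(\<lambda>n. t / real n) \<longlonglongrightarrow> 0" by (rule lim_const_over_n)
    qed
    from filterlim_compose[OF e_lim this]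
    show "(\<lambda>n. W f + t * (B * M * L2_norm (e (t / real n)))) \<longlonglongrightarrow> W f + t * (B * M * 0)"
      by (intro tendsto_intros)
    obtain N where N: "\<omega> * t < real N" using reals_Archimedean2 by blast
    show "\<forall>\<^sub>F n in sequentially. (1 + (- \<omega> * t) / real n) ^ n * W (S t f)
        \<le> W f + t * (B * M * L2_norm (e (t / real n)))"
      using eventually_gt_at_top[of "max N 0"]
    proof eventually_elim
      case (elim n)
      then have n: "0 < n" "\<omega> * t < real n" using N by auto
      then have "\<omega> * (t / real n) < 1" "real n * (t / real n) = t" by (auto simp: field_simps)
      with bound[of "t / real n" n] t n show ?case by (simp add: algebra_simps)
    qed
  qed
  then have "exp (\<omega> * t) * (exp (- \<omega> * t) * W (S t f)) \<le> exp (\<omega> * t) * W f"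
    by (intro mult_left_mono) auto
  then show ?thesis by (simp add: W_def exp_minus field_simps)
qed

text \<open>Both sides are continuous in f for the \<open>L2\<close> norm, since the weight and
  \<open>S t\<close> are bounded, so the estimate extends from the dense domain of the
  generator.\<close>

lemma semigroup_weighted_bound:
  fixes m :: "real^'n \<Rightarrow> complex"
  assumes S: "semigroup_of H S" and dense: "densely_defined H" and \<omega>: "0 \<le> \<omega>" and t: "0 < t"
    and m: "m \<in> borel_measurable lebesgue" "\<And>x. cmod (m x) \<le> B"
    and res: "\<And>l u v. \<omega> < l \<Longrightarrow> (u, v) \<in> H \<Longrightarrow>
      (l - \<omega>) * L2_norm (\<lambda>x. m x * u x) \<le> L2_norm (\<lambda>x. m x * (of_real l * u x + v x))"
    and f: "f \<in> L2"
  shows "L2_norm (\<lambda>x. m x * S t f x) \<le> exp (\<omega> * t) * L2_norm (\<lambda>x. m x * f x)"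
proof -
  have bd: "bounded_L2_operator (S t)" using S t unfolding semigroup_of_def by auto
  obtain K where K: "K \<ge> 0" "\<And>f. f \<in> L2 \<Longrightarrow> L2_norm (S t f) \<le> K * L2_norm f"
    using bounded_L2_operator_bound[OF bd] by blast
  have B: "0 \<le> B" using m(2)[of undefined] norm_ge_zero order_trans by blast
  \<comment> \<open>\<open>B * K\<close> is the loss from replacing \<open>S t f\<close> by
    \<open>S t u\<close>, and \<open>exp (\<omega> * t) * B\<close> the loss from replacing u by
    f.\<close>
  define A where "A = B * K + exp (\<omega> * t) * B"
  have A: "0 \<le> A" using B K(1) by (simp add: A_def)
  define W where "W = (\<lambda>u. L2_norm (\<lambda>x. m x * u x))"
  have mL: "(\<lambda>x. m x * u x) \<in> L2" if "u \<in> L2" for u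
    using L2_mult_bounded[OF that m(1)] m(2) by auto
  have Wdiff: "W u \<le> W v + B * L2_norm (\<lambda>x. u x - v x)" if u: "u \<in> L2" and v: "v \<in> L2" for u v
  proof -
    have "W u \<le> W v + L2_norm (\<lambda>x. m x * (u x - v x))"
      using L2_norm_le_add_diff[OF mL[OF u] mL[OF v]] by (simp add: W_def right_diff_distrib)
    also have "L2_norm (\<lambda>x. m x * (u x - v x)) \<le> B * L2_norm (\<lambda>x. u x - v x)"
      using m B by (intro L2_norm_mult_bounded L2_diff(1) u v) auto
    finally show ?thesis by simp
  qed
  show ?thesis
  proof (rule field_le_epsilon)
    fix \<delta> :: real assume \<delta>: "0 < \<delta>"
    define \<delta>' where "\<delta>' = \<delta> / (A + 1)"
    have \<delta>': "0 < \<delta>'" "A * \<delta>' \<le> \<delta>" using \<delta> A by (auto simp: \<delta>'_def field_simps)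
    obtain u v where uv: "(u, v) \<in> H" "L2_norm (\<lambda>x. f x - u x) < \<delta>'"
      using dense f \<delta>'(1) unfolding densely_defined_def by blast
    have u: "u \<in> L2" using uv(1) S unfolding semigroup_of_def by blast
    note L = bounded_L2_operator_L2[OF bd]
    have 1: "W (S t f) \<le> W (S t u) + B * L2_norm (\<lambda>x. S t f x - S t u x)"
      by (intro Wdiff L f u)
    have "L2_norm (\<lambda>x. S t f x - S t u x) \<le> K * L2_norm (\<lambda>x. f x - u x)"
      unfolding bounded_L2_operator_norm_diff[OF bd f u] by (intro K L2_diff f u)
    then have 2: "B * L2_norm (\<lambda>x. S t f x - S t u x) \<le> B * (K * L2_norm (\<lambda>x. f x - u x))"
      using B by (rule mult_left_mono)
    have 3: "W (S t u) \<le> exp (\<omega> * t) * W u"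
      unfolding W_def by (rule semigroup_weighted_bound_domain[OF S \<omega> t m res uv(1)])
    have "W u \<le> W f + B * L2_norm (\<lambda>x. u x - f x)" by (intro Wdiff f u)
    then have 4: "exp (\<omega> * t) * W u \<le> exp (\<omega> * t) * (W f + B * L2_norm (\<lambda>x. u x - f x))"
      by (intro mult_left_mono) auto
    have "W (S t f) \<le> exp (\<omega> * t) * W f + A * L2_norm (\<lambda>x. f x - u x)"
      using 1 2 3 4 by (simp add: A_def L2_norm_minus_commute[of u f] algebra_simps)
    also have "A * L2_norm (\<lambda>x. f x - u x) \<le> A * \<delta>'"
      using uv(2) A by (intro mult_left_mono) auto
    also note \<delta>'(2)
    finally show "L2_norm (\<lambda>x. m x * S t f x) \<le> exp (\<omega> * t) * L2_norm (\<lambda>x. m x * f x) + \<delta>"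
      by (simp add: W_def)
  qed
qed

section \<open>Smooth functions\<close>

lemma partial_eq: "(f has_derivative D) (at x) \<Longrightarrow> partial i f x = D (axis i 1)"
  by (simp add: partial_def frechet_derivative_at[symmetric])

lemma partial_has_derivative:
  assumes "f differentiable at x"
  obtains D where "(f has_derivative D) (at x)" "\<And>i. partial i f x = D (axis i 1)"
  using assms partial_eq unfolding differentiable_def by blast

lemma partial_const [simp]: "partial i (\<lambda>x. c) = (\<lambda>x. 0)"
  by (rule ext) (simp add: partial_eq[OF has_derivative_const])

lemma partial_add:
  assumes "\<And>x. f differentiable at x" "\<And>x. g differentiable at x"
  shows "partial i (\<lambda>x. f x + g x) = (\<lambda>x. partial i f x + partial i g x)"
proof
  fix x
  obtain D where D: "(f has_derivative D) (at x)" "partial i f x = D (axis i 1)"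
    using partial_has_derivative[OF assms(1)] by metis
  obtain E where E: "(g has_derivative E) (at x)" "partial i g x = E (axis i 1)"
    using partial_has_derivative[OF assms(2)] by metis
  show "partial i (\<lambda>x. f x + g x) x = partial i f x + partial i g x"
    using partial_eq[OF has_derivative_add[OF D(1) E(1)], of i] D(2) E(2) by simp
qed

lemma partial_mult:
  assumes "\<And>x. f differentiable at x" "\<And>x. g differentiable at x"
  shows "partial i (\<lambda>x. f x * g x) = (\<lambda>x. f x * partial i g x + partial i f x * g x)"
proof
  fix x
  obtain D where D: "(f has_derivative D) (at x)" "partial i f x = D (axis i 1)"
    using partial_has_derivative[OF assms(1)] by metis
  obtain E where E: "(g has_derivative E) (at x)" "partial i g x = E (axis i 1)"
    using partial_has_derivative[OF assms(2)] by metis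
  show "partial i (\<lambda>x. f x * g x) x = f x * partial i g x + partial i f x * g x"
    using partial_eq[OF has_derivative_mult[OF D(1) E(1)], of i] D(2) E(2) by simp
qed

lemma has_derivative_compose_real:
  assumes "(g has_real_derivative g') (at (f x))" "(f has_derivative D) (at x)"
  shows "((\<lambda>x. g (f x)) has_derivative (\<lambda>h. g' * D h)) (at x)"
  using has_derivative_compose[OF assms(2), of g "(*) g'"] assms(1)
  by (simp add: has_field_derivative_def)

lemma partial_compose:
  assumes "\<And>x. f differentiable at x" "\<And>y. (g has_real_derivative g' y) (at y)"
  shows "partial i (\<lambda>x. g (f x)) = (\<lambda>x. g' (f x) * partial i f x)"
proof
  fix x
  obtain D where D: "(f has_derivative D) (at x)" "partial i f x = D (axis i 1)"
    using partial_has_derivative[OF assms(1)] by metis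
  show "partial i (\<lambda>x. g (f x)) x = g' (f x) * partial i f x"
    using partial_eq[OF has_derivative_compose_real[OF assms(2) D(1)], of i] D(2) by simp
qed

lemma differentiable_compose_real:
  assumes "f differentiable at x" "\<And>y. (g has_real_derivative g' y) (at y)"
  shows "(\<lambda>x. g (f x)) differentiable at x"
  using has_derivative_compose_real[OF assms(2)] assms(1) unfolding differentiable_def by blast

text \<open>Counting the order makes the product and chain rules provable by induction. The
  recursion peels off the derivative taken first, which is the last entry of the list in
  \<open>foldr partial is f\<close>; this is why lists are split at their end below.\<close>

primrec smooth_upto :: "nat \<Rightarrow> (real^'n \<Rightarrow> real) \<Rightarrow> bool" where
  "smooth_upto 0 f \<longleftrightarrow> (\<forall>x. f differentiable at x)"
| "smooth_upto (Suc n) f \<longleftrightarrow> (\<forall>x. f differentiable at x) \<and> (\<forall>i. smooth_upto n (partial i f))"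

definition smooth :: "(real^'n \<Rightarrow> real) \<Rightarrow> bool" where
  "smooth f \<longleftrightarrow> (\<forall>n. smooth_upto n f)"

lemma smooth_upto_iff:
  "smooth_upto n f \<longleftrightarrow> (\<forall>is. length is \<le> n \<longrightarrow> (\<forall>x. foldr partial is f differentiable at x))"
proof (induction n arbitrary: f)
  case (Suc n)
  have "(\<forall>is. length is \<le> Suc n \<longrightarrow> P is) \<longleftrightarrow> P [] \<and> (\<forall>i is. length is \<le> n \<longrightarrow> P (is @ [i]))"
    for P :: "'a list \<Rightarrow> bool"
    by (metis Suc_le_mono bot_nat_0.extremum length_append_singleton list.size(3) rev_exhaust)
  note * = this[of "\<lambda>is. \<forall>x. foldr partial is f differentiable at x"]
  show ?case unfolding * by (auto simp: Suc.IH)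
qed simp

lemma smooth_iff: "smooth f \<longleftrightarrow> (\<forall>is x. foldr partial is f differentiable at x)"
  unfolding smooth_def smooth_upto_iff by blast

lemma smooth_upto_differentiable: "smooth_upto n f \<Longrightarrow> f differentiable at x"
  by (cases n) auto

lemma smooth_upto_Suc_D: "smooth_upto (Suc n) f \<Longrightarrow> smooth_upto n f"
  by (auto simp: smooth_upto_iff simp del: smooth_upto.simps)

lemma smooth_upto_const: "smooth_upto n (\<lambda>x. c)"
  by (induction n arbitrary: c) auto

lemma smooth_upto_component: "smooth_upto n (\<lambda>x::real^'n. x $ k)"
proof -
  have D: "((\<lambda>x::real^'n. x $ k) has_derivative (\<lambda>h. h $ k)) (at x)" for x
    by (rule bounded_linear.has_derivative[OF bounded_linear_vec_nth]) auto
  then have "partial i (\<lambda>x::real^'n. x $ k) = (\<lambda>x. axis i 1 $ k)" for i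
    using partial_eq[OF D] by auto
  then show ?thesis using D by (cases n) (auto simp: differentiable_def smooth_upto_const)
qed

lemma smooth_upto_add: "smooth_upto n f \<Longrightarrow> smooth_upto n g \<Longrightarrow> smooth_upto n (\<lambda>x. f x + g x)"
  by (induction n arbitrary: f g) (auto simp: partial_add)

lemma smooth_upto_mult: "smooth_upto n f \<Longrightarrow> smooth_upto n g \<Longrightarrow> smooth_upto n (\<lambda>x. f x * g x)"
proof (induction n arbitrary: f g)
  case (Suc n)
  then show ?case
    using smooth_upto_Suc_D[OF Suc.prems(1)] smooth_upto_Suc_D[OF Suc.prems(2)]
    by (auto simp: partial_mult intro!: smooth_upto_add Suc.IH)
qed auto

text \<open>The chain rule turns \<open>g k\<close> after f into a product containing
  \<open>g (Suc k)\<close> after f, so the induction must run over the whole sequence of successive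
  derivatives at once.\<close>

lemma smooth_upto_compose:
  assumes "\<And>k y. (g k has_real_derivative g (Suc k) y) (at y)"
  shows "smooth_upto n f \<Longrightarrow> smooth_upto n (\<lambda>x. g k (f x))"
proof (induction n arbitrary: k)
  case 0
  then show ?case using differentiable_compose_real[OF _ assms, of f] by simp
next
  case (Suc n)
  then have d: "\<And>x. f differentiable at x" by simp
  show ?case
    using Suc.prems smooth_upto_Suc_D[OF Suc.prems]
    by (auto simp: partial_compose[OF d assms] intro!: smooth_upto_mult Suc.IH
        intro: differentiable_compose_real[OF d assms])
qed

lemma smooth_differentiable: "smooth f \<Longrightarrow> f differentiable at x"
  unfolding smooth_def by (meson smooth_upto_differentiable)

lemma smooth_continuous: "smooth f \<Longrightarrow> continuous_on A f"
  using smooth_differentiable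
  by (auto intro!: continuous_at_imp_continuous_on differentiable_imp_continuous_within)

lemma smooth_const: "smooth (\<lambda>x. c)"
  by (simp add: smooth_def smooth_upto_const)

lemma smooth_component: "smooth (\<lambda>x. x $ k)"
  by (simp add: smooth_def smooth_upto_component)

lemma smooth_add: "smooth f \<Longrightarrow> smooth g \<Longrightarrow> smooth (\<lambda>x. f x + g x)"
  by (simp add: smooth_def smooth_upto_add)

lemma smooth_mult: "smooth f \<Longrightarrow> smooth g \<Longrightarrow> smooth (\<lambda>x. f x * g x)"
  by (simp add: smooth_def smooth_upto_mult)

lemma smooth_compose:
  assumes "\<And>k y. (g k has_real_derivative g (Suc k) y) (at y)" "smooth f"
  shows "smooth (\<lambda>x. g k (f x))"
  using assms(2) smooth_upto_compose[of g, OF assms(1)] unfolding smooth_def by blast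

lemma smooth_exp: "smooth f \<Longrightarrow> smooth (\<lambda>x. exp (f x))"
  by (rule smooth_compose[of "\<lambda>k. exp"]) (auto intro: DERIV_exp)

lemma smooth_prod:
  assumes "finite I" "\<And>i. i \<in> I \<Longrightarrow> smooth (f i)"
  shows "smooth (\<lambda>x. \<Prod>i\<in>I. f i x)"
  using assms by (induction I rule: finite_induct) (auto intro: smooth_const smooth_mult)

lemma smooth_partial: "smooth f \<Longrightarrow> smooth (partial i f)"
  unfolding smooth_def using smooth_upto.simps(2) by blast

section \<open>Smooth functions with compact support\<close>

lemma Cc_infinity_iff: "f \<in> Cc_infinity \<longleftrightarrow> smooth f \<and> compact (closure {x. f x \<noteq> 0})"
  by (simp add: Cc_infinity_def smooth_iff)

lemma Cc_infinity_smooth: "f \<in> Cc_infinity \<Longrightarrow> smooth f"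
  by (simp add: Cc_infinity_iff)

lemma Cc_infinity_support_subset:
  assumes "f \<in> Cc_infinity" "smooth g" "{x. g x \<noteq> 0} \<subseteq> closure {x. f x \<noteq> 0}"
  shows "g \<in> Cc_infinity"
proof -
  have "closure {x. g x \<noteq> 0} \<subseteq> closure {x. f x \<noteq> 0}"
    using closure_mono[OF assms(3)] by simp
  then have "compact (closure {x. g x \<noteq> 0})"
    using assms(1) compact_Int_closed[of "closure {x. f x \<noteq> 0}" "closure {x. g x \<noteq> 0}"]
    by (simp add: Cc_infinity_iff Int_absorb1)
  then show ?thesis using assms(2) by (simp add: Cc_infinity_iff)
qed

lemma Cc_infinity_mult:
  assumes "smooth f" "g \<in> Cc_infinity"
  shows "(\<lambda>x. f x * g x) \<in> Cc_infinity"
  using closure_subset[of "{x. g x \<noteq> 0}"] assms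
  by (intro Cc_infinity_support_subset[OF assms(2)] smooth_mult) (auto simp: Cc_infinity_smooth)

lemma Cc_infinity_partial:
  assumes "f \<in> Cc_infinity"
  shows "partial i f \<in> Cc_infinity"
proof (rule Cc_infinity_support_subset[OF assms])
  show "smooth (partial i f)" using assms by (intro smooth_partial Cc_infinity_smooth)
  show "{x. partial i f x \<noteq> 0} \<subseteq> closure {x. f x \<noteq> 0}"
  proof (rule subsetI, rule ccontr)
    fix x assume x: "x \<in> {x. partial i f x \<noteq> 0}" "x \<notin> closure {x. f x \<noteq> 0}"
    have "(f has_derivative (\<lambda>h. 0)) (at x)"
      by (rule has_derivative_transform_within_open[OF has_derivative_const[of 0], of "- closure {x. f x \<noteq> 0}"])
        (use x(2) closure_subset[of "{x. f x \<noteq> 0}"] in auto)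
    then show False using partial_eq x(1) by fastforce
  qed
qed

lemma Cc_infinity_bounded:
  assumes "f \<in> Cc_infinity"
  obtains B where "0 \<le> B" "\<And>x. \<bar>f x\<bar> \<le> B"
proof -
  let ?S = "closure {x. f x \<noteq> 0}"
  have "compact (f ` ?S)"
    using assms by (intro compact_continuous_image smooth_continuous) (auto simp: Cc_infinity_iff)
  then obtain B where B: "\<And>y. y \<in> f ` ?S \<Longrightarrow> norm y \<le> B"
    by (meson bounded_iff compact_imp_bounded)
  have "\<bar>f x\<bar> \<le> max 0 B" for x
  proof (cases "f x = 0")
    case False
    then have "x \<in> ?S" using closure_subset[of "{x. f x \<noteq> 0}"] by auto
    then show ?thesis using B[of "f x"] by auto
  qed simp
  then show thesis by (intro that[of "max 0 B"]) auto
qed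

lemma smooth_measurable: "smooth f \<Longrightarrow> f \<in> borel_measurable lebesgue"
  by (rule measurable_completion) (simp add: borel_measurable_continuous_onI smooth_continuous)

lemma L2_indicator:
  assumes "bounded A" "A \<in> sets lebesgue"
  shows "(indicator A :: real^'n \<Rightarrow> complex) \<in> L2"
proof -
  have "A \<in> lmeasurable" using assms by (rule bounded_set_imp_lmeasurable)
  then have "integrable lebesgue (indicator A :: real^'n \<Rightarrow> real)"
    by (auto simp: fmeasurable_def)
  moreover have "(\<lambda>x::real^'n. (cmod (indicator A x))\<^sup>2) = indicator A"
    by (auto simp: indicator_def)
  ultimately show ?thesis using assms(2) by (simp add: L2_iff)
qed

lemma L2_Cc_infinity:
  assumes "f \<in> Cc_infinity"
  shows "(\<lambda>x. complex_of_real (f x)) \<in> L2"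
proof -
  let ?S = "closure {x. f x \<noteq> 0}"
  obtain B where B: "0 \<le> B" "\<And>x. \<bar>f x\<bar> \<le> B" using Cc_infinity_bounded[OF assms] by metis
  have "bounded ?S" using assms by (simp add: Cc_infinity_iff compact_imp_bounded)
  then have "(indicator ?S :: real^'a \<Rightarrow> complex) \<in> L2" by (rule L2_indicator) auto
  moreover have "(\<lambda>x. complex_of_real (f x)) \<in> borel_measurable lebesgue"
    using smooth_measurable[OF Cc_infinity_smooth[OF assms]] by simp
  moreover have "cmod (complex_of_real (f x)) \<le> B * cmod (indicator ?S x)" for x
    using B closure_subset[of "{x. f x \<noteq> 0}"] by (cases "f x = 0") (auto simp: indicator_def)
  ultimately show ?thesis by (rule L2_dominated(1)[OF _ _ AE_I2])
qed

section \<open>The fundamental lemma of the calculus of variations\<close>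

text \<open>The functions \<open>p(1/t)e\<^bsup>-1/t\<^esup>\<close>, extended by zero to \<open>t \<le> 0\<close>, are closed under differentiation.\<close>

definition flat :: "real poly \<Rightarrow> real \<Rightarrow> real" where
  "flat p t = (if t > 0 then poly p (inverse t) * exp (- inverse t) else 0)"

lemma poly_times_exp_minus_tendsto_0: "((\<lambda>s. poly p s * exp (- s)) \<longlongrightarrow> 0) at_top" for p :: "real poly"
proof -
  have "((\<lambda>s. \<Sum>i\<le>degree p. coeff p i * (s ^ i / exp s)) \<longlongrightarrow> (\<Sum>i\<le>degree p. coeff p i * 0)) at_top"
    by (intro tendsto_intros tendsto_power_div_exp_0)
  then show ?thesis by (simp add: poly_altdef sum_distrib_right exp_minus divide_inverse mult.assoc)
qed

text \<open>With s = 1/t, differentiating p(s)e^(-s) in t gives s^2 (p(s) - p'(s)) e^(-s), and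
  \<open>[:0, 0, 1:]\<close> is the polynomial s^2. At t = 0 exponential decay beats every power of
  s.\<close>

lemma flat_has_derivative:
  "(flat p has_real_derivative flat ([:0, 0, 1:] * (p - pderiv p)) t) (at t)"
proof (cases t "0::real" rule: linorder_cases)
  case less
  have "((\<lambda>t. 0) has_real_derivative 0) (at t)" by simp
  then have "(flat p has_real_derivative 0) (at t)"
    by (rule has_field_derivative_transform_within_open[of _ _ _ "{..<0}"]) (use less in \<open>auto simp: flat_def\<close>)
  then show ?thesis using less by (simp add: flat_def)
next
  case greater
  have "((\<lambda>t. poly p (inverse t) * exp (- inverse t)) has_real_derivative
      flat ([:0, 0, 1:] * (p - pderiv p)) t) (at t)"
    using greater by (auto intro!: derivative_eq_intros
        simp: flat_def algebra_simps power2_eq_square)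
  then show ?thesis
    by (rule has_field_derivative_transform_within_open[of _ _ _ "{0<..}"]) (use greater in \<open>auto simp: flat_def\<close>)
next
  case equal
  have "((\<lambda>h. flat p h / h) \<longlongrightarrow> 0) (at 0)"
  proof (rule filterlim_split_at)
    show "((\<lambda>h. flat p h / h) \<longlongrightarrow> 0) (at_left 0)"
      by (rule tendsto_eventually) (auto simp: eventually_at_filter flat_def)
    \<comment> \<open>Dividing by h multiplies the polynomial in 1/h by its variable, which is
      \<open>pCons 0 p\<close>.\<close>
    have "((\<lambda>h. poly (pCons 0 p) (inverse h) * exp (- inverse h)) \<longlongrightarrow> 0) (at_right (0::real))"
      by (rule filterlim_compose[OF poly_times_exp_minus_tendsto_0 filterlim_inverse_at_top_right])
    then show "((\<lambda>h. flat p h / h) \<longlongrightarrow> 0) (at_right 0)"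
      by (rule Lim_transform_eventually)
        (auto simp: eventually_at_filter flat_def divide_inverse mult_ac)
  qed
  then show ?thesis using equal by (simp add: DERIV_def flat_def)
qed

lemma smooth_flat: "smooth f \<Longrightarrow> smooth (\<lambda>x. flat 1 (f x))"
  using smooth_compose[of "\<lambda>k. flat (((\<lambda>p. [:0, 0, 1:] * (p - pderiv p)) ^^ k) 1)" f 0]
    flat_has_derivative by simp

text \<open>The common majorant and the pointwise limit are what dominated convergence asks for when
  integrals against test functions are turned into integrals over boxes.\<close>

lemma Cc_infinity_box_approximation:
  fixes a b :: "real^'n"
  obtains \<eta> where "\<And>k. \<eta> k \<in> Cc_infinity" "\<And>k x. \<bar>\<eta> k x\<bar> \<le> indicator (box a b) x"
    "\<And>x. (\<lambda>k::nat. \<eta> k x) \<longlonglongrightarrow> indicator (box a b) x"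
proof -
  \<comment> \<open>\<open>flat 1\<close> is positive exactly on the positive reals, so the product
    is positive exactly on the open box. Differences are spelled as sums and products to fit the
    closure rules for smoothness.\<close>
  define \<beta> where "\<beta> = (\<lambda>x::real^'n. \<Prod>i\<in>UNIV. flat 1 (x $ i + (- a $ i)) * flat 1 (b $ i + (-1) * x $ i))"
  have sm: "smooth \<beta>" unfolding \<beta>_def
    by (intro smooth_prod smooth_mult smooth_flat smooth_add smooth_const smooth_component) auto
  have nn: "0 \<le> \<beta> x" for x by (auto simp: \<beta>_def flat_def intro!: prod_nonneg)
  have nz: "\<beta> x \<noteq> 0 \<longleftrightarrow> x \<in> box a b" for x
    by (auto simp: \<beta>_def flat_def mem_box_cart not_less split: if_splits) (meson not_le)+
  \<comment> \<open>\<open>1 - e\<^bsup>-k\<beta>\<^esup>\<close> increases to the indicator of \<open>{\<beta> > 0}\<close>, which is the box.\<close>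
  define \<eta> where "\<eta> = (\<lambda>(k::nat) x. 1 + (-1) * exp ((- real k) * \<beta> x))"
  have out: "\<eta> k x = 0" if "x \<notin> box a b" for k x using nz[of x] that by (simp add: \<eta>_def)
  show thesis
  proof (rule that[of \<eta>])
    fix k
    have "smooth (\<eta> k)" unfolding \<eta>_def
      by (intro smooth_add smooth_mult smooth_exp smooth_const sm)
    moreover have "{x. \<eta> k x \<noteq> 0} \<subseteq> box a b" using out by blast
    then have "bounded {x. \<eta> k x \<noteq> 0}" using bounded_box bounded_subset by blast
    ultimately show "\<eta> k \<in> Cc_infinity" by (simp add: Cc_infinity_iff)
    show "\<bar>\<eta> k x\<bar> \<le> indicator (box a b) x" for x
      using out[of x k] nn[of x] by (cases "x \<in> box a b") (auto simp: \<eta>_def)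
  next
    fix x
    show "(\<lambda>k. \<eta> k x) \<longlonglongrightarrow> indicator (box a b) x"
    proof (cases "x \<in> box a b")
      case True
      then have "0 < \<beta> x" using nn[of x] nz[of x] by (simp add: less_le)
      then have "norm (exp (- \<beta> x)) < 1" by simp
      then have "(\<lambda>k. exp (- \<beta> x) ^ k) \<longlonglongrightarrow> 0" by (rule LIMSEQ_power_zero)
      then have "(\<lambda>k. 1 + (-1) * exp (- \<beta> x) ^ k) \<longlonglongrightarrow> 1 + (-1) * 0"
        by (intro tendsto_add tendsto_mult tendsto_const)
      then show ?thesis using True by (simp add: \<eta>_def exp_of_nat_mult[symmetric])
    qed (simp add: out)
  qed
qed

lemma sigma_finite_lebesgue: "sigma_finite_measure (lebesgue :: 'a::euclidean_space measure)"
proof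
  obtain A :: "'a set set" where "countable A" "A \<subseteq> sets lborel" "\<Union>A = space lborel" "\<forall>a\<in>A. emeasure lborel a \<noteq> \<infinity>"
    using lborel.sigma_finite_countable by blast
  then show "\<exists>A :: 'a set set. countable A \<and> A \<subseteq> sets lebesgue \<and> \<Union>A = space lebesgue \<and> (\<forall>a\<in>A. emeasure lebesgue a \<noteq> \<infinity>)"
    by (intro exI[of _ A]) (auto simp: emeasure_completion)
qed

text \<open>Boxes form an intersection-stable generator of the Borel sets, so the sets over which F
  integrates to 0 are handled by Dynkin induction. Complements need the total integral to be 0; as
  the whole space is not a box in this sense, F is required to live on one.\<close>

lemma AE_zero_if_integral_box_zero:
  fixes F :: "real^'n \<Rightarrow> complex"
  assumes F: "integrable lebesgue F"
    and box: "\<And>a b. (LINT x:box a b|lebesgue. F x) = 0"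
    and sup: "\<And>x. x \<notin> box c d \<Longrightarrow> F x = 0"
  shows "AE x in lebesgue. F x = 0"
proof (rule sigma_finite_measure.density_zero[OF sigma_finite_lebesgue F])
  have SI: "set_integrable lebesgue A F" if "A \<in> sets lebesgue" for A
    unfolding set_integrable_def by (rule integrable_mult_indicator[OF that F])
  have tot: "(LINT x|lebesgue. F x) = 0"
  proof -
    have "(LINT x|lebesgue. F x) = (LINT x:box c d|lebesgue. F x)"
      unfolding set_lebesgue_integral_def using sup
      by (intro Bochner_Integration.integral_cong) (auto simp: indicator_def)
    then show ?thesis using box by simp
  qed
  have leb: "A \<in> sets lebesgue" if "A \<in> sigma_sets UNIV (range (\<lambda>(a, b). box a b :: (real^'n) set))" for A
  proof -
    have "sets borel = sigma_sets UNIV (range (\<lambda>(a, b). box a b :: (real^'n) set))"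
      by (simp add: borel_eq_box)
    then show ?thesis using that by auto
  qed
  have borel: "(LINT x:A|lebesgue. F x) = 0" if "A \<in> sets borel" for A
  proof -
    have "Int_stable (range (\<lambda>(a, b). box a b :: (real^'n) set))"
      by (auto simp: Int_stable_def box_Int_box)
    moreover have "range (\<lambda>(a, b). box a b :: (real^'n) set) \<subseteq> Pow UNIV" by simp
    moreover have "A \<in> sigma_sets UNIV (range (\<lambda>(a, b). box a b :: (real^'n) set))"
      using that by (simp add: borel_eq_box)
    ultimately show ?thesis
    proof (induction rule: sigma_sets_induct_disjoint[consumes 3])
      case (basic A)
      then show ?case using box by auto
    next
      case empty
      then show ?case by (simp add: set_lebesgue_integral_def)
    next
      case (compl A)
      then have A: "A \<in> sets lebesgue" by (intro leb)
      have "(LINT x:UNIV - A|lebesgue. F x) = (LINT x|lebesgue. F x) - (LINT x:A|lebesgue. F x)"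
        unfolding set_lebesgue_integral_def
        by (subst Bochner_Integration.integral_diff[symmetric, OF F SI[OF A, unfolded set_integrable_def]])
          (auto intro!: Bochner_Integration.integral_cong simp: indicator_def)
      then show ?case using compl tot by simp
    next
      case (union A)
      then have A: "A i \<in> sets lebesgue" for i by (intro leb) auto
      have "(LINT x:(\<Union>i. A i)|lebesgue. F x) = (\<Sum>i. (LINT x:A i|lebesgue. F x))"
        using union A by (intro lebesgue_integral_countable_add SI sets.countable_UN) (auto simp: disjoint_family_on_def)
      then show ?case using union by simp
    qed
  qed
  fix A :: "(real^'n) set" assume "A \<in> sets lebesgue"
  then obtain S N N' where S: "A = S \<union> N" "N \<subseteq> N'" "N' \<in> null_sets lborel" "S \<in> sets lborel"
    by (rule sets_completionE)
  \<comment> \<open>A Lebesgue set differs from its Borel part only inside a null set.\<close>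
  have "(LINT x:A|lebesgue. F x) = (LINT x:S|lebesgue. F x)"
    unfolding set_lebesgue_integral_def
  proof (rule integral_cong_AE)
    show "AE x in lebesgue. indicat_real A x *\<^sub>R F x = indicat_real S x *\<^sub>R F x"
      using AE_completion[OF AE_not_in[OF S(3)]] by eventually_elim (use S in \<open>auto simp: indicator_def\<close>)
  qed (use SI \<open>A \<in> sets lebesgue\<close> S(4) in \<open>auto simp: set_integrable_def intro: borel_measurable_integrable\<close>)
  then show "(LINT x:A|lebesgue. F x) = 0" using borel S(4) by simp
qed

text \<open>Approximating indicators by test functions shows that f integrates to 0 over every box.
  Since f is only square integrable, the passage to a.e. vanishing is made for its restrictions to
  the cubes (-n, n)^d, which exhaust the space; the intersection of a box with a cube is again a
  box.\<close>

lemma fundamental_lemma_calculus_of_variations: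
  fixes f :: "real^'n \<Rightarrow> complex"
  assumes f: "f \<in> L2" and zero: "\<And>\<eta>. \<eta> \<in> Cc_infinity \<Longrightarrow> (LINT x|lebesgue. f x * of_real (\<eta> x)) = 0"
  shows "AE x in lebesgue. f x = 0"
proof -
  have ind: "(indicator (box a b) :: real^'n \<Rightarrow> complex) \<in> L2" for a b :: "real^'n"
    by (rule L2_indicator) auto
  have box: "(LINT x|lebesgue. f x * indicator (box a b) x) = 0" for a b
  proof -
    obtain \<eta> where \<eta>: "\<And>k::nat. \<eta> k \<in> Cc_infinity" "\<And>k x. \<bar>\<eta> k x\<bar> \<le> indicator (box a b) x"
        "\<And>x. (\<lambda>k. \<eta> k x) \<longlonglongrightarrow> indicator (box a b) x"
      using Cc_infinity_box_approximation by blast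
    have "(\<lambda>k. LINT x|lebesgue. f x * of_real (\<eta> k x)) \<longlonglongrightarrow> (LINT x|lebesgue. f x * indicator (box a b) x)"
    proof (rule integral_dominated_convergence)
      show "integrable lebesgue (\<lambda>x. cmod (f x) * cmod (indicator (box a b) x))"
        by (rule L2_integrable_norm_mult[OF f ind])
      show "AE x in lebesgue. (\<lambda>k. f x * of_real (\<eta> k x)) \<longlonglongrightarrow> f x * indicator (box a b) x"
        using tendsto_mult[OF tendsto_const tendsto_of_real[OF \<eta>(3)]] by (auto simp: of_real_indicator)
      have "cmod (indicator (box a b) x) = indicator (box a b) x" for x
        by (simp add: indicator_def)
      then show "AE x in lebesgue. cmod (f x * of_real (\<eta> k x)) \<le> cmod (f x) * cmod (indicator (box a b) x)" for k
        using \<eta>(2)[of k] by (intro AE_I2) (simp only: norm_mult norm_of_real mult_left_mono norm_ge_zero)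
      show "(\<lambda>x. f x * of_real (\<eta> k x)) \<in> borel_measurable lebesgue" for k
        using L2_measurable[OF f] L2_measurable[OF L2_Cc_infinity[OF \<eta>(1)]] by simp
    qed (use L2_measurable[OF f] L2_measurable[OF ind] in simp)
    then show ?thesis using zero[OF \<eta>(1)] by (simp add: LIMSEQ_const_iff)
  qed
  have "AE x in lebesgue. \<forall>n::nat. f x * indicator (box (\<chi> i. - real n) (\<chi> i. real n)) x = 0"
  proof (subst AE_all_countable, rule allI)
    fix n :: nat
    let ?c = "(\<chi> i. - real n) :: real^'n" and ?d = "(\<chi> i. real n) :: real^'n"
    show "AE x in lebesgue. f x * indicator (box ?c ?d) x = 0"
    proof (rule AE_zero_if_integral_box_zero[where c = ?c and d = ?d])
      show "integrable lebesgue (\<lambda>x. f x * indicator (box ?c ?d) x)"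
        by (rule L2_integrable_mult[OF f ind])
      fix a b :: "real^'n"
      obtain p q where pq: "box a b \<inter> box ?c ?d = box p q" by (simp add: box_Int_box)
      have "indicator (box a b) x *\<^sub>R (f x * indicator (box ?c ?d) x) = f x * indicator (box p q) x" for x
        unfolding pq[symmetric] by (auto simp: indicator_def)
      then show "(LINT x:box a b|lebesgue. f x * indicator (box ?c ?d) x) = 0"
        using box by (simp add: set_lebesgue_integral_def)
    qed auto
  qed
  then show ?thesis
  proof eventually_elim
    case (elim x)
    obtain n where n: "norm x < real n" using reals_Archimedean2 by blast
    have "x \<in> box (\<chi> i. - real n) (\<chi> i. real n)"
      using component_le_norm_cart[of x] n by (auto simp: mem_box_cart abs_le_iff) (smt (verit))+
    then show ?case using elim[rule_format, of n] by simp
  qed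
qed

section \<open>Products of weakly differentiable and smooth functions\<close>

text \<open>This identifies the choice made by \<open>weak_partial\<close> with any weak derivative
  found by explicit computation.\<close>

lemma is_weak_partial_unique:
  assumes "g \<in> L2" "g' \<in> L2" "is_weak_partial i f g" "is_weak_partial i f g'"
  shows "AE x in lebesgue. g x = g' x"
proof -
  have "AE x in lebesgue. g x - g' x = 0"
  proof (rule fundamental_lemma_calculus_of_variations[OF L2_diff(1)[OF assms(1,2)]])
    fix \<eta> :: "real^'a \<Rightarrow> real" assume \<eta>: "\<eta> \<in> Cc_infinity"
    have "(LINT x|lebesgue. g x * of_real (\<eta> x)) = (LINT x|lebesgue. g' x * of_real (\<eta> x))"
      using bspec[OF assms(3)[unfolded is_weak_partial_def] \<eta>]
        bspec[OF assms(4)[unfolded is_weak_partial_def] \<eta>] by simp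
    then show "(LINT x|lebesgue. (g x - g' x) * of_real (\<eta> x)) = 0"
      using L2_integrable_mult(1)[OF _ L2_Cc_infinity[OF \<eta>]] assms(1,2) by (simp add: left_diff_distrib)
  qed
  then show ?thesis by simp
qed

lemma W12_L2: "f \<in> W12 \<Longrightarrow> f \<in> L2"
  by (simp add: W12_def)

lemma W12_weak_partial:
  assumes "f \<in> W12"
  shows "weak_partial i f \<in> L2" "is_weak_partial i f (weak_partial i f)"
  using someI_ex[of "\<lambda>g. g \<in> L2 \<and> is_weak_partial i f g"] assms
  by (auto simp: W12_def weak_partial_def)

lemma smooth_bounded_mult_L2:
  assumes "smooth m" "\<And>x. \<bar>m x\<bar> \<le> B" "u \<in> L2"
  shows "(\<lambda>x. complex_of_real (m x) * u x) \<in> L2"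
  using smooth_measurable[OF assms(1)] assms(2)
  by (intro L2_mult_bounded[OF assms(3), where B = B]) auto

text \<open>The product m\<eta> is again a test function, and m times the derivative of \<eta> is
  the derivative of m\<eta> minus \<eta> times the derivative of m. The bounds on m and its
  derivative keep each term integrable, so the integral may be split.\<close>

lemma is_weak_partial_mult:
  assumes u: "u \<in> L2" and g: "g \<in> L2" and w: "is_weak_partial i u g"
    and m: "smooth m" "\<And>x. \<bar>m x\<bar> \<le> B" "\<And>x. \<bar>partial i m x\<bar> \<le> B"
  shows "is_weak_partial i (\<lambda>x. of_real (m x) * u x) (\<lambda>x. of_real (m x) * g x + of_real (partial i m x) * u x)"
  unfolding is_weak_partial_def
proof
  fix \<eta> :: "real^'a \<Rightarrow> real" assume \<eta>: "\<eta> \<in> Cc_infinity"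
  have m\<eta>: "(\<lambda>x. m x * \<eta> x) \<in> Cc_infinity" by (rule Cc_infinity_mult[OF m(1) \<eta>])
  have pm: "partial i (\<lambda>x. m x * \<eta> x) = (\<lambda>x. m x * partial i \<eta> x + partial i m x * \<eta> x)"
    by (intro partial_mult smooth_differentiable m(1) Cc_infinity_smooth[OF \<eta>])
  have I1: "integrable lebesgue (\<lambda>x. of_real (partial i m x) * u x * of_real (\<eta> x))"
    by (intro L2_integrable_mult(1) smooth_bounded_mult_L2[OF smooth_partial[OF m(1)] m(3) u] L2_Cc_infinity \<eta>)
  have I2: "integrable lebesgue (\<lambda>x. of_real (m x) * g x * of_real (\<eta> x))"
    by (intro L2_integrable_mult(1) smooth_bounded_mult_L2[OF m(1,2) g] L2_Cc_infinity \<eta>)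
  have I3: "integrable lebesgue (\<lambda>x. u x * of_real (partial i (\<lambda>x. m x * \<eta> x) x))"
    by (intro L2_integrable_mult(1) u L2_Cc_infinity Cc_infinity_partial m\<eta>)
  have "(LINT x|lebesgue. of_real (m x) * u x * of_real (partial i \<eta> x))
      = (LINT x|lebesgue. u x * of_real (partial i (\<lambda>x. m x * \<eta> x) x) - of_real (partial i m x) * u x * of_real (\<eta> x))"
    unfolding pm by (intro Bochner_Integration.integral_cong) (auto simp: algebra_simps)
  also have "\<dots> = (LINT x|lebesgue. u x * of_real (partial i (\<lambda>x. m x * \<eta> x) x))
      - (LINT x|lebesgue. of_real (partial i m x) * u x * of_real (\<eta> x))"
    by (rule Bochner_Integration.integral_diff[OF I3 I1])
  also have "(LINT x|lebesgue. u x * of_real (partial i (\<lambda>x. m x * \<eta> x) x))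
      = - (LINT x|lebesgue. g x * of_real (m x * \<eta> x))"
    using w m\<eta> by (simp add: is_weak_partial_def)
  also have "(LINT x|lebesgue. g x * of_real (m x * \<eta> x)) = (LINT x|lebesgue. of_real (m x) * g x * of_real (\<eta> x))"
    by (intro Bochner_Integration.integral_cong) (auto simp: mult_ac)
  also have "- (LINT x|lebesgue. of_real (m x) * g x * of_real (\<eta> x))
        - (LINT x|lebesgue. of_real (partial i m x) * u x * of_real (\<eta> x))
      = - (LINT x|lebesgue. (of_real (m x) * g x + of_real (partial i m x) * u x) * of_real (\<eta> x))"
    by (simp add: distrib_right Bochner_Integration.integral_add[OF I2 I1])
  finally show "(LINT x|lebesgue. of_real (m x) * u x * of_real (partial i \<eta> x))
      = - (LINT x|lebesgue. (of_real (m x) * g x + of_real (partial i m x) * u x) * of_real (\<eta> x))" .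
qed

lemma W12_mult:
  assumes u: "u \<in> W12" and m: "smooth m" "\<And>x. \<bar>m x\<bar> \<le> B" "\<And>i x. \<bar>partial i m x\<bar> \<le> B"
  shows "(\<lambda>x. of_real (m x) * u x) \<in> W12"
    "AE x in lebesgue. weak_partial i (\<lambda>x. of_real (m x) * u x) x
       = of_real (m x) * weak_partial i u x + of_real (partial i m x) * u x"
proof -
  note uL = W12_L2[OF u]
  let ?g = "\<lambda>i x. of_real (m x) * weak_partial i u x + of_real (partial i m x) * u x"
  have gL: "?g i \<in> L2" for i
    by (intro L2_add(1) smooth_bounded_mult_L2[OF m(1,2)] smooth_bounded_mult_L2[OF smooth_partial[OF m(1)] m(3)]
        W12_weak_partial u uL)
  have gw: "is_weak_partial i (\<lambda>x. of_real (m x) * u x) (?g i)" for i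
    by (rule is_weak_partial_mult[OF uL W12_weak_partial[OF u] m])
  show *: "(\<lambda>x. of_real (m x) * u x) \<in> W12"
    unfolding W12_def using smooth_bounded_mult_L2[OF m(1,2) uL] gL gw by blast
  show "AE x in lebesgue. weak_partial i (\<lambda>x. of_real (m x) * u x) x = ?g i x"
    by (rule is_weak_partial_unique[OF W12_weak_partial(1)[OF *] gL W12_weak_partial(2)[OF *] gw])
qed

section \<open>Weighted estimates for the resolvents\<close>

lemma inner_matrix_vector: "x \<bullet> (A *v y) = (\<Sum>i\<in>UNIV. \<Sum>j\<in>UNIV. x $ i * (A $ i $ j * y $ j))"
  for A :: "real^'n^'n"
  by (simp add: inner_vec_def matrix_vector_mult_def sum_distrib_left)

text \<open>Completing the square: by symmetry of A, the right side plus c^2 times the form at p is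
  the form at x + cp, which is nonnegative.\<close>

lemma psd_twisted:
  fixes A :: "real^'n^'n"
  assumes "transpose A = A" "\<And>\<xi>. 0 \<le> \<xi> \<bullet> (A *v \<xi>)"
  shows "- c\<^sup>2 * (p \<bullet> (A *v p)) \<le> (x + (2 * c) *\<^sub>R p) \<bullet> (A *v x)"
proof -
  have "x \<bullet> (A *v p) = p \<bullet> (A *v x)"
    using dot_lmul_matrix[of x A p] assms(1)
    by (metis inner_commute transpose_matrix_vector)
  moreover have "0 \<le> (x + c *\<^sub>R p) \<bullet> (A *v (x + c *\<^sub>R p))" by (rule assms(2))
  ultimately show ?thesis
    by (simp add: matrix_vector_right_distrib matrix_vector_mult_scaleR inner_add_left inner_add_right
        power2_eq_square algebra_simps)
qed

text \<open>A is real, so the real part of the sesquilinear expression splits into the real forms of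
  the real and imaginary parts; the square is completed in each, with c = \<rho> Re z and c = \<rho>
  Im z.\<close>

lemma psd_twisted_complex:
  fixes A :: "real^'n^'n" and \<xi> :: "'n \<Rightarrow> complex" and p :: "'n \<Rightarrow> real"
  assumes "transpose A = A" "\<And>\<xi>. 0 \<le> \<xi> \<bullet> (A *v \<xi>)"
  shows "- \<rho>\<^sup>2 * (cmod z)\<^sup>2 * (\<Sum>i\<in>UNIV. \<Sum>j\<in>UNIV. A $ i $ j * p i * p j)
    \<le> Re (\<Sum>i\<in>UNIV. \<Sum>j\<in>UNIV. cnj (\<xi> i + of_real (2 * \<rho> * p i) * z) * (of_real (A $ i $ j) * \<xi> j))"
proof -
  let ?p = "\<chi> i. p i" and ?x = "\<chi> i. Re (\<xi> i)" and ?y = "\<chi> i. Im (\<xi> i)"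
  have "(\<Sum>i\<in>UNIV. \<Sum>j\<in>UNIV. A $ i $ j * p i * p j) = ?p \<bullet> (A *v ?p)"
    by (simp add: inner_matrix_vector mult_ac)
  moreover have "Re (\<Sum>i\<in>UNIV. \<Sum>j\<in>UNIV. cnj (\<xi> i + of_real (2 * \<rho> * p i) * z) * (of_real (A $ i $ j) * \<xi> j))
    = (?x + (2 * (\<rho> * Re z)) *\<^sub>R ?p) \<bullet> (A *v ?x) + (?y + (2 * (\<rho> * Im z)) *\<^sub>R ?p) \<bullet> (A *v ?y)"
    by (simp add: inner_matrix_vector sum.distrib[symmetric] algebra_simps)
  moreover have "- \<rho>\<^sup>2 * (cmod z)\<^sup>2 * (?p \<bullet> (A *v ?p))
      = - (\<rho> * Re z)\<^sup>2 * (?p \<bullet> (A *v ?p)) + - (\<rho> * Im z)\<^sup>2 * (?p \<bullet> (A *v ?p))"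
    by (simp add: cmod_power2 power_mult_distrib distrib_left left_diff_distrib)
  ultimately show ?thesis
    using add_mono[OF psd_twisted[OF assms, of "\<rho> * Re z" ?p ?x] psd_twisted[OF assms, of "\<rho> * Im z" ?p ?y]]
    by presburger
qed

section \<open>Bounds for coefficients, test functions and exponential weights\<close>

lemma Linf_bounded:
  assumes "f \<in> Linf"
  obtains B where "AE x in lebesgue. \<bar>f x\<bar> \<le> B" "f \<in> borel_measurable lebesgue"
proof -
  have f: "f \<in> borel_measurable lebesgue" "esssup lebesgue (\<lambda>x. ereal \<bar>f x\<bar>) < \<infinity>"
    using assms by (auto simp: Linf_def)
  obtain n :: nat where n: "esssup lebesgue (\<lambda>x. ereal \<bar>f x\<bar>) < ereal (real n)"
    using f(2) less_PInf_Ex_of_nat by auto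
  have "AE x in lebesgue. \<bar>f x\<bar> \<le> real n"
    using esssup_AE[of "\<lambda>x. ereal \<bar>f x\<bar>" lebesgue]
  proof eventually_elim
    case (elim x)
    have "ereal \<bar>f x\<bar> < ereal (real n)" by (rule le_less_trans[OF elim n])
    then show ?case by simp
  qed
  then show thesis using f(1) that by blast
qed

lemma test_functions_AE:
  assumes "\<psi> \<in> test_functions C"
  shows "AE x in lebesgue. (\<Sum>i\<in>UNIV. \<Sum>j\<in>UNIV. C x $ i $ j * partial i \<psi> x * partial j \<psi> x) \<le> 1"
  using esssup_AE[of "\<lambda>x. ereal \<bar>\<Sum>i\<in>UNIV. \<Sum>j\<in>UNIV. C x $ i $ j * partial i \<psi> x * partial j \<psi> x\<bar>" lebesgue]
proof eventually_elim
  case (elim x)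
  have "esssup lebesgue (\<lambda>x. ereal \<bar>\<Sum>i\<in>UNIV. \<Sum>j\<in>UNIV. C x $ i $ j * partial i \<psi> x * partial j \<psi> x\<bar>) \<le> ereal 1"
    using assms by (simp add: test_functions_def one_ereal_def)
  with elim have "ereal \<bar>\<Sum>i\<in>UNIV. \<Sum>j\<in>UNIV. C x $ i $ j * partial i \<psi> x * partial j \<psi> x\<bar> \<le> ereal 1"
    by (rule order_trans)
  then show ?case by simp
qed

text \<open>The weight equals 1 off the support of \<psi>, so it is smooth and bounded with bounded
  first derivatives but not compactly supported. A single constant bounds the weight and all its
  partial derivatives, as \<open>W12_mult\<close> expects.\<close>

lemma Cc_infinity_exp_weight:
  fixes \<psi> :: "real^'n \<Rightarrow> real"
  assumes \<psi>: "\<psi> \<in> Cc_infinity"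
  obtains B where "smooth (\<lambda>x. exp (c * \<psi> x))" "\<And>x. \<bar>exp (c * \<psi> x)\<bar> \<le> B"
    "\<And>i x. \<bar>partial i (\<lambda>x. exp (c * \<psi> x)) x\<bar> \<le> B"
    "\<And>i. partial i (\<lambda>x. exp (c * \<psi> x)) = (\<lambda>x. exp (c * \<psi> x) * (c * partial i \<psi> x))"
proof -
  note sm = Cc_infinity_smooth[OF \<psi>]
  have sc: "smooth (\<lambda>x. c * \<psi> x)" by (intro smooth_mult smooth_const sm)
  have pc: "partial i (\<lambda>x. c * \<psi> x) = (\<lambda>x. c * partial i \<psi> x)" for i
    using partial_mult[of "\<lambda>x. c" \<psi> i] smooth_differentiable[OF sm] by simp
  have p: "partial i (\<lambda>x. exp (c * \<psi> x)) = (\<lambda>x. exp (c * \<psi> x) * (c * partial i \<psi> x))" for i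
    using partial_compose[of "\<lambda>x. c * \<psi> x" exp exp i] smooth_differentiable[OF sc] by (simp add: pc DERIV_exp)
  obtain K where K: "0 \<le> K" "\<And>x. \<bar>\<psi> x\<bar> \<le> K" using Cc_infinity_bounded[OF \<psi>] by metis
  have "\<exists>L\<ge>0. \<forall>x. \<bar>partial i \<psi> x\<bar> \<le> L" for i
    using Cc_infinity_bounded[OF Cc_infinity_partial[OF \<psi>]] by metis
  then obtain L where L: "\<And>i. 0 \<le> L i" "\<And>i x. \<bar>partial i \<psi> x\<bar> \<le> L i" by metis
  let ?E = "exp (\<bar>c\<bar> * K)"
  \<comment> \<open>The summand 1 serves the weight itself; the sum over all directions serves every
    partial derivative.\<close>
  let ?B = "?E * (1 + \<bar>c\<bar> * (\<Sum>i\<in>UNIV. L i))"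
  have S: "L i \<le> (\<Sum>i\<in>UNIV. L i)" for i using L(1) by (intro member_le_sum) auto
  have E: "exp (c * \<psi> x) \<le> ?E" for x
  proof -
    have "c * \<psi> x \<le> \<bar>c * \<psi> x\<bar>" by simp
    also have "\<dots> \<le> \<bar>c\<bar> * K" using K(2)[of x] by (simp add: abs_mult mult_left_mono)
    finally show ?thesis by simp
  qed
  have S0: "0 \<le> (\<Sum>i\<in>UNIV. L i)" using L(1) by (simp add: sum_nonneg)
  show thesis
  proof (rule that[of ?B])
    show "smooth (\<lambda>x. exp (c * \<psi> x))" by (rule smooth_exp[OF sc])
    show "\<bar>exp (c * \<psi> x)\<bar> \<le> ?B" for x
    proof -
      have "?E * 1 \<le> ?B" using S0 by (intro mult_left_mono) auto
      moreover have "\<bar>exp (c * \<psi> x)\<bar> \<le> ?E * 1" using E[of x] by simp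
      ultimately show ?thesis by (rule order_trans[rotated])
    qed
    fix i x
    have "\<bar>c * partial i \<psi> x\<bar> \<le> 1 + \<bar>c\<bar> * (\<Sum>i\<in>UNIV. L i)"
      using mult_left_mono[OF order_trans[OF L(2)[of i x] S[of i]], of "\<bar>c\<bar>"] by (simp add: abs_mult)
    then have "\<bar>exp (c * \<psi> x)\<bar> * \<bar>c * partial i \<psi> x\<bar> \<le> ?B"
      using E[of x] by (intro mult_mono) auto
    then show "\<bar>partial i (\<lambda>x. exp (c * \<psi> x)) x\<bar> \<le> ?B" by (simp add: p abs_mult)
    show "partial i (\<lambda>x. exp (c * \<psi> x)) = (\<lambda>x. exp (c * \<psi> x) * (c * partial i \<psi> x))" by (rule p)
  qed
qed

text \<open>The gradient of e^(2\<rho>\<psi>)u is e^(2\<rho>\<psi>) times (grad u + 2\<rho>u grad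
  \<psi>), so the integrand of the form is e^(2\<rho>\<psi>) times the expression in
  \<open>psd_twisted_complex\<close>. The test-function condition bounds the part with
  \<open>C\<close> by 1, and \<open>K\<close> bounds the Euclidean part.\<close>

lemma H_eps_weighted_lower_bound:
  fixes C :: "real^'n \<Rightarrow> real^'n^'n"
  assumes C: "coefficient_matrix C" and \<psi>: "\<psi> \<in> test_functions C" and \<epsilon>: "0 < \<epsilon>"
    and K: "\<And>x. (\<Sum>i\<in>UNIV. (partial i \<psi> x)\<^sup>2) \<le> K"
    and uv: "(u, v) \<in> H_eps C \<epsilon>"
  shows "- (\<rho>\<^sup>2 * (1 + \<epsilon> * K)) * (L2_norm (\<lambda>x. of_real (exp (\<rho> * \<psi> x)) * u x))\<^sup>2
    \<le> Re (L2_inner (\<lambda>x. of_real (exp (2 * \<rho> * \<psi> x)) * u x) v)"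
proof -
  have \<psi>C: "\<psi> \<in> Cc_infinity" using \<psi> by (simp add: test_functions_def)
  let ?w = "\<lambda>x. exp (2 * \<rho> * \<psi> x)"
  let ?\<phi> = "\<lambda>x. complex_of_real (?w x) * u x"
  obtain B where w: "smooth ?w" "\<And>x. \<bar>?w x\<bar> \<le> B" "\<And>i x. \<bar>partial i ?w x\<bar> \<le> B"
    and pw: "\<And>i. partial i ?w = (\<lambda>x. ?w x * (2 * \<rho> * partial i \<psi> x))"
    by (rule Cc_infinity_exp_weight[OF \<psi>C, of "2 * \<rho>"]) (rule that)
  have u: "u \<in> W12" and form: "\<And>w. w \<in> W12 \<Longrightarrow> h_form C w u + of_real \<epsilon> * l_form w u = L2_inner w v"
    using uv by (auto simp: H_eps_def form_operator_def)
  note uL = W12_L2[OF u]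
  note \<phi> = W12_mult(1)[OF u w]
  let ?D = "\<lambda>i. weak_partial i u" and ?W = "\<lambda>i. weak_partial i ?\<phi>"
  note D = W12_weak_partial(1)[OF u] and W = W12_weak_partial(1)[OF \<phi>]
  have CD: "(\<lambda>x. complex_of_real (C x $ i $ j) * ?D j x) \<in> L2" for i j
  proof -
    have "(\<lambda>x. C x $ i $ j) \<in> Linf" using C by (simp add: coefficient_matrix_def)
    then obtain B where "AE x in lebesgue. \<bar>C x $ i $ j\<bar> \<le> B" "(\<lambda>x. C x $ i $ j) \<in> borel_measurable lebesgue"
      by (rule Linf_bounded)
    then show ?thesis by (intro L2_mult_bounded[OF D, where B = B]) auto
  qed
  let ?G = "\<lambda>x. (\<Sum>i\<in>UNIV. \<Sum>j\<in>UNIV. cnj (?W i x) * (complex_of_real (C x $ i $ j) * ?D j x))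
      + of_real \<epsilon> * (\<Sum>i\<in>UNIV. cnj (?W i x) * ?D i x)"
  have I1: "integrable lebesgue (\<lambda>x. cnj (?W i x) * (complex_of_real (C x $ i $ j) * ?D j x))" for i j
    by (rule L2_integrable_mult(2)[OF W CD])
  have I2: "integrable lebesgue (\<lambda>x. cnj (?W i x) * ?D i x)" for i
    by (rule L2_integrable_mult(2)[OF W D])
  have IG: "integrable lebesgue ?G"
    by (intro Bochner_Integration.integrable_add integrable_mult_right Bochner_Integration.integrable_sum I1 I2)
  have "L2_inner ?\<phi> v = h_form C ?\<phi> u + of_real \<epsilon> * l_form ?\<phi> u"
    by (rule form[OF \<phi>, symmetric])
  also have "\<dots> = (LINT x|lebesgue. ?G x)"
    unfolding h_form_def l_form_def L2_inner_def using I1 I2 by (simp add: integrable_sum)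
  finally have eq: "Re (L2_inner ?\<phi> v) = (LINT x|lebesgue. Re (?G x))"
    by (simp only: integral_Re[OF IG])
  have AEW: "AE x in lebesgue. \<forall>i. ?W i x = of_real (?w x) * (?D i x + of_real (2 * \<rho> * partial i \<psi> x) * u x)"
  proof (subst AE_all_countable, rule allI)
    fix i
    show "AE x in lebesgue. ?W i x = of_real (?w x) * (?D i x + of_real (2 * \<rho> * partial i \<psi> x) * u x)"
      using W12_mult(2)[OF u w, of i] unfolding pw by eventually_elim (simp add: algebra_simps)
  qed
  have AEC: "AE x in lebesgue. transpose (C x) = C x \<and> (\<forall>\<xi>. 0 \<le> \<xi> \<bullet> (C x *v \<xi>))"
    using C by (simp add: coefficient_matrix_def)
  have "AE x in lebesgue. - (\<rho>\<^sup>2 * (1 + \<epsilon> * K)) * (cmod (of_real (exp (\<rho> * \<psi> x)) * u x))\<^sup>2 \<le> Re (?G x)"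
    using AEW AEC test_functions_AE[OF \<psi>]
  proof eventually_elim
    case (elim x)
    let ?p = "\<lambda>i. partial i \<psi> x" and ?\<xi> = "\<lambda>i. ?D i x + of_real (2 * \<rho> * partial i \<psi> x) * u x"
    let ?Q = "\<Sum>i\<in>UNIV. \<Sum>j\<in>UNIV. C x $ i $ j * ?p i * ?p j"
    \<comment> \<open>The regularising form has the identity as its coefficient matrix, so the same
      pointwise inequality treats both forms.\<close>
    have id: "transpose (mat 1 :: real^'n^'n) = mat 1" "\<And>\<xi>. 0 \<le> \<xi> \<bullet> ((mat 1 :: real^'n^'n) *v \<xi>)"
      by (auto simp: transpose_mat)
    have c1: "- \<rho>\<^sup>2 * (cmod (u x))\<^sup>2 * ?Q
        \<le> Re (\<Sum>i\<in>UNIV. \<Sum>j\<in>UNIV. cnj (?\<xi> i) * (of_real (C x $ i $ j) * ?D j x))"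
      using elim(2) by (intro psd_twisted_complex) auto
    have c2: "- \<rho>\<^sup>2 * (cmod (u x))\<^sup>2 * (\<Sum>i\<in>UNIV. (?p i)\<^sup>2) \<le> Re (\<Sum>i\<in>UNIV. cnj (?\<xi> i) * ?D i x)"
      using psd_twisted_complex[OF id, of \<rho> "u x" ?p "\<lambda>i. ?D i x"]
      by (simp add: mat_def if_distrib[of "\<lambda>c. c * _"] if_distrib[of "\<lambda>c. _ * c"] if_distrib[of complex_of_real]
          sum.delta power2_eq_square cong: if_cong)
    have G: "?G x = of_real (?w x) * ((\<Sum>i\<in>UNIV. \<Sum>j\<in>UNIV. cnj (?\<xi> i) * (of_real (C x $ i $ j) * ?D j x))
        + of_real \<epsilon> * (\<Sum>i\<in>UNIV. cnj (?\<xi> i) * ?D i x))"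
      using elim(1) by (simp add: sum_distrib_left mult_ac distrib_left)
    have "?Q + \<epsilon> * (\<Sum>i\<in>UNIV. (?p i)\<^sup>2) \<le> 1 + \<epsilon> * K"
      using elim(3) K[of x] \<epsilon> by (intro add_mono mult_left_mono) auto
    then have "\<rho>\<^sup>2 * (cmod (u x))\<^sup>2 * (?Q + \<epsilon> * (\<Sum>i\<in>UNIV. (?p i)\<^sup>2)) \<le> \<rho>\<^sup>2 * (cmod (u x))\<^sup>2 * (1 + \<epsilon> * K)"
      by (rule mult_left_mono) simp
    then have "- (\<rho>\<^sup>2 * (1 + \<epsilon> * K)) * (cmod (u x))\<^sup>2
        \<le> - \<rho>\<^sup>2 * (cmod (u x))\<^sup>2 * ?Q + \<epsilon> * (- \<rho>\<^sup>2 * (cmod (u x))\<^sup>2 * (\<Sum>i\<in>UNIV. (?p i)\<^sup>2))"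
      by (simp add: algebra_simps)
    also have "\<dots> \<le> Re (\<Sum>i\<in>UNIV. \<Sum>j\<in>UNIV. cnj (?\<xi> i) * (of_real (C x $ i $ j) * ?D j x))
        + \<epsilon> * Re (\<Sum>i\<in>UNIV. cnj (?\<xi> i) * ?D i x)"
      using c1 c2 \<epsilon> by (intro add_mono mult_left_mono) auto
    finally have "?w x * (- (\<rho>\<^sup>2 * (1 + \<epsilon> * K)) * (cmod (u x))\<^sup>2) \<le> ?w x * \<dots>"
      by (intro mult_left_mono) auto
    also have "\<dots> = Re (?G x)" unfolding G by simp
    also have "?w x = (exp (\<rho> * \<psi> x))\<^sup>2" by (simp add: exp_double[symmetric] mult.assoc)
    finally show ?case by (simp add: norm_mult power_mult_distrib mult_ac)
  qed
  moreover have "integrable lebesgue (\<lambda>x. (cmod (of_real (exp (\<rho> * \<psi> x)) * u x))\<^sup>2)"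
  proof -
    obtain B' where B': "smooth (\<lambda>x. exp (\<rho> * \<psi> x))" "\<And>x. \<bar>exp (\<rho> * \<psi> x)\<bar> \<le> B'"
      by (rule Cc_infinity_exp_weight[OF \<psi>C, of \<rho>]) (rule that)
    from smooth_bounded_mult_L2[OF B' uL] show ?thesis by (simp add: L2_iff)
  qed
  ultimately have "(LINT x|lebesgue. - (\<rho>\<^sup>2 * (1 + \<epsilon> * K)) * (cmod (of_real (exp (\<rho> * \<psi> x)) * u x))\<^sup>2)
      \<le> (LINT x|lebesgue. Re (?G x))"
    by (intro integral_mono_AE integrable_mult_right integrable_Re IG)
  then show ?thesis unfolding eq L2_norm_power2 by simp
qed

lemma Cc_infinity_exp_bounded:
  assumes "\<psi> \<in> Cc_infinity"
  obtains B where "(\<lambda>x. complex_of_real (exp (\<rho> * \<psi> x))) \<in> borel_measurable lebesgue"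
    "\<And>x. cmod (complex_of_real (exp (\<rho> * \<psi> x))) \<le> B"
proof -
  obtain B where B: "smooth (\<lambda>x. exp (\<rho> * \<psi> x))" "\<And>x. \<bar>exp (\<rho> * \<psi> x)\<bar> \<le> B"
    by (rule Cc_infinity_exp_weight[OF assms, of \<rho>]) (rule that)
  show thesis
    by (rule that[of B]) (use smooth_measurable[OF B(1)] B(2) in auto)
qed

text \<open>Pairing e^(\<rho>\<psi>)u with e^(\<rho>\<psi>)f produces l times the squared weighted
  norm of u plus the quantity bounded from below for the form. Cauchy-Schwarz bounds the pairing
  from above, and one factor of the norm is cancelled.\<close>

lemma H_eps_weighted_resolvent_bound:
  fixes C :: "real^'n \<Rightarrow> real^'n^'n"
  assumes C: "coefficient_matrix C" and \<psi>: "\<psi> \<in> test_functions C" and \<epsilon>: "0 < \<epsilon>"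
    and K: "\<And>x. (\<Sum>i\<in>UNIV. (partial i \<psi> x)\<^sup>2) \<le> K"
    and uv: "(u, v) \<in> H_eps C \<epsilon>" and f: "f \<in> L2" and ae: "AE x in lebesgue. of_real l * u x + v x = f x"
  shows "(l - \<rho>\<^sup>2 * (1 + \<epsilon> * K)) * L2_norm (\<lambda>x. of_real (exp (\<rho> * \<psi> x)) * u x)
    \<le> L2_norm (\<lambda>x. of_real (exp (\<rho> * \<psi> x)) * f x)"
proof -
  have \<psi>C: "\<psi> \<in> Cc_infinity" using \<psi> by (simp add: test_functions_def)
  let ?m = "\<lambda>x. complex_of_real (exp (\<rho> * \<psi> x))"
  obtain B where m: "?m \<in> borel_measurable lebesgue" "\<And>x. cmod (?m x) \<le> B"
    by (rule Cc_infinity_exp_bounded[OF \<psi>C, of \<rho>]) (rule that)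
  have mL: "(\<lambda>x. ?m x * g x) \<in> L2" if "g \<in> L2" for g
    by (rule L2_mult_bounded[OF that m(1)]) (use m(2) in auto)
  have u: "u \<in> L2" and v: "v \<in> L2" using uv by (auto simp: H_eps_def form_operator_def W12_def)
  let ?n = "L2_norm (\<lambda>x. ?m x * u x)" and ?\<omega> = "\<rho>\<^sup>2 * (1 + \<epsilon> * K)"
  have mm: "complex_of_real (exp (2 * \<rho> * \<psi> x)) = ?m x * ?m x" for x
    by (simp add: exp_double[symmetric] power2_eq_square[symmetric] mult.assoc flip: of_real_power of_real_mult)
  have I1: "integrable lebesgue (\<lambda>x. cnj (?m x * u x) * (?m x * u x))"
    by (intro L2_integrable_mult mL u)
  have I2: "integrable lebesgue (\<lambda>x. cnj (?m x * u x) * (?m x * v x))"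
    by (intro L2_integrable_mult mL u v)
  have "L2_inner (\<lambda>x. ?m x * u x) (\<lambda>x. ?m x * f x)
      = (LINT x|lebesgue. of_real l * (cnj (?m x * u x) * (?m x * u x)) + cnj (?m x * u x) * (?m x * v x))"
    unfolding L2_inner_def
  proof (rule integral_cong_AE)
    show "AE x in lebesgue. cnj (?m x * u x) * (?m x * f x)
        = of_real l * (cnj (?m x * u x) * (?m x * u x)) + cnj (?m x * u x) * (?m x * v x)"
      using ae
    proof eventually_elim
      case (elim x)
      show ?case unfolding elim[symmetric] by (simp add: algebra_simps)
    qed
    show "(\<lambda>x. cnj (?m x * u x) * (?m x * f x)) \<in> borel_measurable lebesgue"
      by (intro borel_measurable_integrable L2_integrable_mult mL u f)
    show "(\<lambda>x. of_real l * (cnj (?m x * u x) * (?m x * u x)) + cnj (?m x * u x) * (?m x * v x)) \<in> borel_measurable lebesgue"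
      using I1 I2 by (intro borel_measurable_integrable Bochner_Integration.integrable_add integrable_mult_right)
  qed
  also have "\<dots> = of_real l * L2_inner (\<lambda>x. ?m x * u x) (\<lambda>x. ?m x * u x)
      + L2_inner (\<lambda>x. of_real (exp (2 * \<rho> * \<psi> x)) * u x) v"
  proof -
    have "L2_inner (\<lambda>x. of_real (exp (2 * \<rho> * \<psi> x)) * u x) v = (LINT x|lebesgue. cnj (?m x * u x) * (?m x * v x))"
      unfolding L2_inner_def mm by (intro Bochner_Integration.integral_cong) (simp_all add: mult_ac)
    then show ?thesis
      unfolding L2_inner_def
      by (subst Bochner_Integration.integral_add[OF integrable_mult_right[OF I1] I2]) simp
  qed
  also have "L2_inner (\<lambda>x. ?m x * u x) (\<lambda>x. ?m x * u x) = of_real (?n\<^sup>2)"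
    unfolding L2_norm_power2 L2_inner_def
    by (subst integral_complex_of_real[symmetric])
      (intro Bochner_Integration.integral_cong refl, subst mult.commute, rule complex_norm_square[symmetric])
  finally have "Re (L2_inner (\<lambda>x. ?m x * u x) (\<lambda>x. ?m x * f x))
      = l * ?n\<^sup>2 + Re (L2_inner (\<lambda>x. of_real (exp (2 * \<rho> * \<psi> x)) * u x) v)" by simp
  then have "(l - ?\<omega>) * ?n\<^sup>2 \<le> Re (L2_inner (\<lambda>x. ?m x * u x) (\<lambda>x. ?m x * f x))"
    using H_eps_weighted_lower_bound[OF C \<psi> \<epsilon> K uv, of \<rho>] by (simp add: left_diff_distrib)
  also have "\<dots> \<le> ?n * L2_norm (\<lambda>x. ?m x * f x)"
    using complex_Re_le_cmod L2_Cauchy_Schwarz[OF mL[OF u] mL[OF f]] by (rule order_trans)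
  finally have *: "?n * ((l - ?\<omega>) * ?n) \<le> ?n * L2_norm (\<lambda>x. ?m x * f x)"
    by (simp add: power2_eq_square mult_ac)
  show ?thesis
  \<comment> \<open>Cancellation requires a positive norm; for norm 0 the left side of the claim is
    0.\<close>
  proof (cases "?n = 0")
    case False
    then have "0 < ?n" by (simp add: less_le)
    with * show ?thesis by simp
  qed simp
qed

text \<open>For a fixed right-hand side f the bounds on \<open>R \<epsilon> f\<close> pass to the
  limit, because the weighted norm is continuous on \<open>L2\<close> and \<epsilon>K tends to 0.
  The condition on l also gives l > 0, where strong resolvent convergence is available.\<close>

lemma viscosity_operator_weighted_resolvent_bound:
  fixes C :: "real^'n \<Rightarrow> real^'n^'n"
  assumes C: "coefficient_matrix C" and \<psi>: "\<psi> \<in> test_functions C" and H0: "viscosity_operator C H\<^sub>0"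
    and l: "\<rho>\<^sup>2 < l" and uv: "(u, v) \<in> H\<^sub>0"
  shows "(l - \<rho>\<^sup>2) * L2_norm (\<lambda>x. of_real (exp (\<rho> * \<psi> x)) * u x)
    \<le> L2_norm (\<lambda>x. of_real (exp (\<rho> * \<psi> x)) * (of_real l * u x + v x))"
proof -
  have \<psi>C: "\<psi> \<in> Cc_infinity" using \<psi> by (simp add: test_functions_def)
  let ?m = "\<lambda>x. complex_of_real (exp (\<rho> * \<psi> x))"
  obtain B where m: "?m \<in> borel_measurable lebesgue" "\<And>x. cmod (?m x) \<le> B"
    by (rule Cc_infinity_exp_bounded[OF \<psi>C, of \<rho>]) (rule that)
  have B: "0 \<le> B" using m(2)[of undefined] norm_ge_zero order_trans by blast
  have mL: "(\<lambda>x. ?m x * g x) \<in> L2" if "g \<in> L2" for g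
    by (rule L2_mult_bounded[OF that m(1)]) (use m(2) in auto)
  have "\<exists>L. \<forall>x. (partial i \<psi> x)\<^sup>2 \<le> L" for i
  proof -
    obtain L where "0 \<le> L" "\<And>x. \<bar>partial i \<psi> x\<bar> \<le> L"
      using Cc_infinity_bounded[OF Cc_infinity_partial[OF \<psi>C, of i]] by metis
    then have "(partial i \<psi> x)\<^sup>2 \<le> L\<^sup>2" for x
      using power_mono[of "\<bar>partial i \<psi> x\<bar>" L 2] by simp
    then show ?thesis by blast
  qed
  then obtain L where L: "\<And>i x. (partial i \<psi> x)\<^sup>2 \<le> L i" by metis
  define K where "K = (\<Sum>i\<in>UNIV. L i)"
  have K: "(\<Sum>i\<in>UNIV. (partial i \<psi> x)\<^sup>2) \<le> K" for x unfolding K_def by (intro sum_mono L)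
  have l0: "0 < l" using l zero_le_power2[of \<rho>] by linarith
  obtain R R\<^sub>0 where R: "\<And>\<epsilon>. \<epsilon> \<in> {0<..1} \<Longrightarrow> is_resolvent (H_eps C \<epsilon>) l (R \<epsilon>)"
    and R0: "is_resolvent H\<^sub>0 l R\<^sub>0"
    and lim: "\<And>f. f \<in> L2 \<Longrightarrow> ((\<lambda>\<epsilon>. L2_norm (\<lambda>x. R \<epsilon> f x - R\<^sub>0 f x)) \<longlongrightarrow> 0) (at_right 0)"
    using H0 l0 unfolding viscosity_operator_def strong_resolvent_limit_def by blast
  have uvL: "u \<in> L2" "v \<in> L2"
  proof -
    have "adjoint_graph H\<^sub>0 = H\<^sub>0"
      using H0 by (simp add: viscosity_operator_def positive_self_adjoint_def)
    then have "(u, v) \<in> adjoint_graph H\<^sub>0" using uv by simp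
    then show "u \<in> L2" "v \<in> L2" by (auto simp: adjoint_graph_def)
  qed
  \<comment> \<open>This choice makes the limiting resolvent return u almost everywhere, turning a
    bound on resolvents into one on the graph.\<close>
  define f where "f = (\<lambda>x. of_real l * u x + v x)"
  have f: "f \<in> L2" unfolding f_def by (intro L2_add(1) L2_cmult uvL)
  have R0u: "AE x in lebesgue. R\<^sub>0 f x = u x"
    using R0 uv unfolding is_resolvent_def f_def by fast
  have R0L: "R\<^sub>0 f \<in> L2" using R0 f by (simp add: is_resolvent_def bounded_L2_operator_L2)
  have RL: "R \<epsilon> f \<in> L2" if "\<epsilon> \<in> {0<..1}" for \<epsilon>
    using R[OF that] f by (simp add: is_resolvent_def bounded_L2_operator_L2)
  let ?W = "\<lambda>g. L2_norm (\<lambda>x. ?m x * g x)"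
  have ev: "\<forall>\<^sub>F \<epsilon> in at_right 0. \<epsilon> \<in> {0<..1::real}"
    using eventually_at_right_real[of 0 1] by (rule eventually_mono) auto
  have "((\<lambda>\<epsilon>. ?W (R \<epsilon> f) - ?W (R\<^sub>0 f)) \<longlongrightarrow> 0) (at_right 0)"
  proof (rule Lim_null_comparison)
    show "((\<lambda>\<epsilon>. B * L2_norm (\<lambda>x. R \<epsilon> f x - R\<^sub>0 f x)) \<longlongrightarrow> 0) (at_right 0)"
      using tendsto_mult_left[OF lim[OF f], of B] by simp
    show "\<forall>\<^sub>F \<epsilon> in at_right 0. norm (?W (R \<epsilon> f) - ?W (R\<^sub>0 f)) \<le> B * L2_norm (\<lambda>x. R \<epsilon> f x - R\<^sub>0 f x)"
      using ev
    proof eventually_elim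
      case (elim \<epsilon>)
      have "norm (?W (R \<epsilon> f) - ?W (R\<^sub>0 f)) \<le> L2_norm (\<lambda>x. ?m x * R \<epsilon> f x - ?m x * R\<^sub>0 f x)"
        unfolding real_norm_def by (intro L2_norm_abs_diff mL RL[OF elim] R0L)
      also have "\<dots> = L2_norm (\<lambda>x. ?m x * (R \<epsilon> f x - R\<^sub>0 f x))" by (simp add: right_diff_distrib)
      also have "\<dots> \<le> B * L2_norm (\<lambda>x. R \<epsilon> f x - R\<^sub>0 f x)"
        by (rule L2_norm_mult_bounded[OF L2_diff(1)[OF RL[OF elim] R0L] m(1) _ B]) (use m(2) in auto)
      finally show ?case .
    qed
  qed
  then have WR: "((\<lambda>\<epsilon>. ?W (R \<epsilon> f)) \<longlongrightarrow> ?W (R\<^sub>0 f)) (at_right 0)"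
    by (rule Lim_null[THEN iffD2])
  have id: "((\<lambda>\<epsilon>::real. \<epsilon>) \<longlongrightarrow> 0) (at_right 0)" by (rule tendsto_ident_at)
  have "(l - \<rho>\<^sup>2 * (1 + 0 * K)) * ?W (R\<^sub>0 f) \<le> ?W f"
  proof (rule tendsto_upperbound)
    show "((\<lambda>\<epsilon>. (l - \<rho>\<^sup>2 * (1 + \<epsilon> * K)) * ?W (R \<epsilon> f)) \<longlongrightarrow> (l - \<rho>\<^sup>2 * (1 + 0 * K)) * ?W (R\<^sub>0 f)) (at_right 0)"
      by (intro tendsto_intros WR id)
    show "\<forall>\<^sub>F \<epsilon> in at_right 0. (l - \<rho>\<^sup>2 * (1 + \<epsilon> * K)) * ?W (R \<epsilon> f) \<le> ?W f"
      using ev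
    proof eventually_elim
      case (elim \<epsilon>)
      obtain v' where "(R \<epsilon> f, v') \<in> H_eps C \<epsilon>" "AE x in lebesgue. of_real l * R \<epsilon> f x + v' x = f x"
        using R[OF elim] f unfolding is_resolvent_def by blast
      then show ?case using elim by (intro H_eps_weighted_resolvent_bound[OF C \<psi> _ K _ f]) auto
    qed
  qed simp
  moreover have "?W (R\<^sub>0 f) = ?W u"
    by (intro L2_norm_cong mL R0L uvL eventually_mono[OF R0u]) simp
  ultimately show ?thesis by (simp add: f_def)
qed

lemma viscosity_semigroup_weighted_bound:
  fixes C :: "real^'n \<Rightarrow> real^'n^'n"
  assumes C: "coefficient_matrix C" and S: "viscosity_semigroup C S" and \<psi>: "\<psi> \<in> test_functions C"
    and t: "0 < t" and f: "f \<in> L2"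
  shows "L2_norm (\<lambda>x. of_real (exp (\<rho> * \<psi> x)) * S t f x)
    \<le> exp (\<rho>\<^sup>2 * t) * L2_norm (\<lambda>x. of_real (exp (\<rho> * \<psi> x)) * f x)"
proof -
  obtain H\<^sub>0 where H0: "viscosity_operator C H\<^sub>0" and S0: "semigroup_of H\<^sub>0 S"
    using S by (auto simp: viscosity_semigroup_def)
  have dense: "densely_defined H\<^sub>0"
    using H0 by (simp add: viscosity_operator_def positive_self_adjoint_def)
  have \<psi>C: "\<psi> \<in> Cc_infinity" using \<psi> by (simp add: test_functions_def)
  let ?m = "\<lambda>x. complex_of_real (exp (\<rho> * \<psi> x))"
  obtain B where m: "?m \<in> borel_measurable lebesgue" "\<And>x. cmod (?m x) \<le> B"
    by (rule Cc_infinity_exp_bounded[OF \<psi>C, of \<rho>]) (rule that)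
  show ?thesis
    by (rule semigroup_weighted_bound[OF S0 dense zero_le_power2 t m
          viscosity_operator_weighted_resolvent_bound[OF C \<psi> H0] f])
qed

section \<open>The off-diagonal bound\<close>

lemma test_function_diff_less:
  assumes "\<psi> \<in> test_functions C" "y \<in> B_C C x r"
  shows "\<bar>\<psi> x - \<psi> y\<bar> < r"
proof -
  have "ereal \<bar>\<psi> x - \<psi> y\<bar> \<le> d_C C x y" unfolding d_C_def using assms(1) by (rule SUP_upper)
  also have "\<dots> < ereal r" using assms(2) by (simp add: B_C_def)
  finally show ?thesis by simp
qed

text \<open>The absolute value of \<rho> allows either sign: the two functions in the final pairing
  carry opposite weights.\<close>

lemma L2_on_weighted_norm:
  fixes \<psi> :: "real^'n \<Rightarrow> real"
  assumes \<psi>: "\<psi> \<in> test_functions C" and f: "f \<in> L2_on (B_C C x r)"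
  shows "L2_norm (\<lambda>y. of_real (exp (\<rho> * \<psi> y)) * f y) \<le> exp (\<rho> * \<psi> x + \<bar>\<rho>\<bar> * r) * L2_norm f"
proof -
  have \<psi>C: "\<psi> \<in> Cc_infinity" using \<psi> by (simp add: test_functions_def)
  have fL: "f \<in> L2" and out: "AE y in lebesgue. y \<notin> B_C C x r \<longrightarrow> f y = 0"
    using f by (auto simp: L2_on_def)
  let ?m = "\<lambda>x. complex_of_real (exp (\<rho> * \<psi> x))"
  obtain B where m: "?m \<in> borel_measurable lebesgue" "\<And>x. cmod (?m x) \<le> B"
    by (rule Cc_infinity_exp_bounded[OF \<psi>C, of \<rho>]) (rule that)
  show ?thesis
  proof (rule L2_dominated(2)[OF fL])
    show "(\<lambda>y. ?m y * f y) \<in> borel_measurable lebesgue"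
      using m(1) L2_measurable[OF fL] by simp
    show "AE y in lebesgue. cmod (?m y * f y) \<le> exp (\<rho> * \<psi> x + \<bar>\<rho>\<bar> * r) * cmod (f y)"
      using out
    proof eventually_elim
      case (elim y)
      show ?case
      proof (cases "y \<in> B_C C x r")
        case True
        have "\<rho> * \<psi> y - \<rho> * \<psi> x \<le> \<bar>\<rho> * (\<psi> x - \<psi> y)\<bar>" by (simp add: right_diff_distrib)
        also have "\<dots> \<le> \<bar>\<rho>\<bar> * r"
          using test_function_diff_less[OF \<psi> True] by (simp add: abs_mult mult_left_mono)
        finally show ?thesis by (simp add: norm_mult mult_right_mono)
      qed (use elim in simp)
    qed
  qed simp
qed

text \<open>The alternative \<open>D = 0\<close> serves balls at distance zero, whose centres may
  not be separated by r_1 + r_2. There \<rho> = 0, and the estimate reduces to contractivity of the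
  semigroup.\<close>

lemma viscosity_semigroup_test_function_bound:
  fixes C :: "real^'n \<Rightarrow> real^'n^'n"
  assumes C: "coefficient_matrix C" and S: "viscosity_semigroup C S" and \<psi>: "\<psi> \<in> test_functions C"
    and \<phi>: "\<phi>\<^sub>1 \<in> L2_on (B_C C x\<^sub>1 r\<^sub>1)" "\<phi>\<^sub>2 \<in> L2_on (B_C C x\<^sub>2 r\<^sub>2)"
    and t: "0 < t" and D: "0 \<le> D" "D = 0 \<or> D + r\<^sub>1 + r\<^sub>2 \<le> \<bar>\<psi> x\<^sub>1 - \<psi> x\<^sub>2\<bar>"
  shows "cmod (L2_inner \<phi>\<^sub>1 (S t \<phi>\<^sub>2)) \<le> exp (- (D\<^sup>2 / (4 * t))) * (L2_norm \<phi>\<^sub>1 * L2_norm \<phi>\<^sub>2)"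
proof -
  have \<psi>C: "\<psi> \<in> Cc_infinity" using \<psi> by (simp add: test_functions_def)
  have \<phi>L: "\<phi>\<^sub>1 \<in> L2" "\<phi>\<^sub>2 \<in> L2" using \<phi> by (auto simp: L2_on_def)
  have "bounded_L2_operator (S t)"
    using S t by (auto simp: viscosity_semigroup_def semigroup_of_def)
  then have SL: "S t \<phi>\<^sub>2 \<in> L2" using \<phi>L(2) by (rule bounded_L2_operator_L2)
  define \<delta> where "\<delta> = \<psi> x\<^sub>1 - \<psi> x\<^sub>2"
  \<comment> \<open>The modulus D/(2t) minimises \<rho>^2 t - \<rho>D, with value -D^2/(4t). The
    sign is that of \<delta>, so that \<rho>\<delta> is nonnegative whichever centre has the larger
    value of \<psi>.\<close>
  define \<rho> where "\<rho> = (if \<delta> < 0 then - 1 else 1) * (D / (2 * t))"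
  have \<rho>: "\<rho> * \<delta> = \<bar>\<rho>\<bar> * \<bar>\<delta>\<bar>" "\<bar>\<rho>\<bar> = D / (2 * t)" using D(1) t by (auto simp: \<rho>_def abs_mult)
  have wL: "(\<lambda>x. complex_of_real (exp (c * \<psi> x)) * g x) \<in> L2" if "g \<in> L2" for c g
  proof -
    obtain B where "(\<lambda>x. complex_of_real (exp (c * \<psi> x))) \<in> borel_measurable lebesgue"
        "\<And>x. cmod (complex_of_real (exp (c * \<psi> x))) \<le> B"
      by (rule Cc_infinity_exp_bounded[OF \<psi>C, of c]) (rule that)
    then show ?thesis by (intro L2_mult_bounded[OF \<open>g \<in> L2\<close>, where B = B] AE_I2)
  qed
  have "L2_inner \<phi>\<^sub>1 (S t \<phi>\<^sub>2) = L2_inner (\<lambda>x. of_real (exp ((- \<rho>) * \<psi> x)) * \<phi>\<^sub>1 x) (\<lambda>x. of_real (exp (\<rho> * \<psi> x)) * S t \<phi>\<^sub>2 x)"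
    unfolding L2_inner_def
  proof (intro Bochner_Integration.integral_cong refl)
    fix x
    have "complex_of_real (exp ((- \<rho>) * \<psi> x)) * of_real (exp (\<rho> * \<psi> x)) = 1"
      by (simp flip: of_real_mult exp_add)
    then show "cnj (\<phi>\<^sub>1 x) * S t \<phi>\<^sub>2 x = cnj (of_real (exp ((- \<rho>) * \<psi> x)) * \<phi>\<^sub>1 x) * (of_real (exp (\<rho> * \<psi> x)) * S t \<phi>\<^sub>2 x)"
      by (simp only: complex_cnj_mult complex_cnj_complex_of_real mult_ac) (simp add: mult.assoc[symmetric])
  qed
  then have "cmod (L2_inner \<phi>\<^sub>1 (S t \<phi>\<^sub>2))
      \<le> L2_norm (\<lambda>x. of_real (exp ((- \<rho>) * \<psi> x)) * \<phi>\<^sub>1 x) * L2_norm (\<lambda>x. of_real (exp (\<rho> * \<psi> x)) * S t \<phi>\<^sub>2 x)"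
    using L2_Cauchy_Schwarz[OF wL[OF \<phi>L(1), of "- \<rho>"] wL[OF SL, of \<rho>]] by simp
  also have "\<dots> \<le> (exp ((- \<rho>) * \<psi> x\<^sub>1 + \<bar>- \<rho>\<bar> * r\<^sub>1) * L2_norm \<phi>\<^sub>1)
      * (exp (\<rho>\<^sup>2 * t) * (exp (\<rho> * \<psi> x\<^sub>2 + \<bar>\<rho>\<bar> * r\<^sub>2) * L2_norm \<phi>\<^sub>2))"
  proof (rule mult_mono)
    show "L2_norm (\<lambda>x. of_real (exp ((- \<rho>) * \<psi> x)) * \<phi>\<^sub>1 x) \<le> exp ((- \<rho>) * \<psi> x\<^sub>1 + \<bar>- \<rho>\<bar> * r\<^sub>1) * L2_norm \<phi>\<^sub>1"
      by (rule L2_on_weighted_norm[OF \<psi> \<phi>(1)])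
    have "L2_norm (\<lambda>x. of_real (exp (\<rho> * \<psi> x)) * S t \<phi>\<^sub>2 x) \<le> exp (\<rho>\<^sup>2 * t) * L2_norm (\<lambda>x. of_real (exp (\<rho> * \<psi> x)) * \<phi>\<^sub>2 x)"
      by (rule viscosity_semigroup_weighted_bound[OF C S \<psi> t \<phi>L(2)])
    also have "\<dots> \<le> exp (\<rho>\<^sup>2 * t) * (exp (\<rho> * \<psi> x\<^sub>2 + \<bar>\<rho>\<bar> * r\<^sub>2) * L2_norm \<phi>\<^sub>2)"
      by (intro mult_left_mono L2_on_weighted_norm[OF \<psi> \<phi>(2)]) auto
    finally show "L2_norm (\<lambda>x. of_real (exp (\<rho> * \<psi> x)) * S t \<phi>\<^sub>2 x)
        \<le> exp (\<rho>\<^sup>2 * t) * (exp (\<rho> * \<psi> x\<^sub>2 + \<bar>\<rho>\<bar> * r\<^sub>2) * L2_norm \<phi>\<^sub>2)" .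
  qed auto
  also have "\<dots> = exp (\<rho>\<^sup>2 * t - (\<rho> * \<delta> - \<bar>\<rho>\<bar> * (r\<^sub>1 + r\<^sub>2))) * (L2_norm \<phi>\<^sub>1 * L2_norm \<phi>\<^sub>2)"
  proof -
    have "\<rho>\<^sup>2 * t - (\<rho> * \<delta> - \<bar>\<rho>\<bar> * (r\<^sub>1 + r\<^sub>2))
        = ((- \<rho>) * \<psi> x\<^sub>1 + \<bar>- \<rho>\<bar> * r\<^sub>1) + (\<rho>\<^sup>2 * t + (\<rho> * \<psi> x\<^sub>2 + \<bar>\<rho>\<bar> * r\<^sub>2))"
      by (simp add: \<delta>_def algebra_simps)
    then show ?thesis by (simp only: exp_add mult_ac)
  qed
  also have "\<dots> \<le> exp (- (D\<^sup>2 / (4 * t))) * (L2_norm \<phi>\<^sub>1 * L2_norm \<phi>\<^sub>2)"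
  proof (intro mult_right_mono)
    \<comment> \<open>For D = 0 the factor |\<rho>| is 0, which matters because |\<delta>| - (r_1 +
      r_2) may then be negative.\<close>
    have "\<bar>\<rho>\<bar> * D \<le> \<bar>\<rho>\<bar> * (\<bar>\<delta>\<bar> - (r\<^sub>1 + r\<^sub>2))"
    proof (cases "D = 0")
      case True
      then show ?thesis by (simp add: \<rho>(2))
    next
      case False
      then show ?thesis using D(2) by (intro mult_left_mono) (auto simp: \<delta>_def)
    qed
    moreover have "\<rho>\<^sup>2 * t - \<bar>\<rho>\<bar> * D = - (D\<^sup>2 / (4 * t))"
    proof -
      have "\<rho>\<^sup>2 = (D / (2 * t))\<^sup>2" by (simp flip: \<rho>(2))
      then show ?thesis using t by (simp add: \<rho>(2) power2_eq_square field_simps)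
    qed
    ultimately show "exp (\<rho>\<^sup>2 * t - (\<rho> * \<delta> - \<bar>\<rho>\<bar> * (r\<^sub>1 + r\<^sub>2))) \<le> exp (- (D\<^sup>2 / (4 * t)))"
      unfolding \<rho>(1) by (simp add: right_diff_distrib)
  qed simp
  finally show ?thesis .
qed

text \<open>A test function available for every \<open>C\<close>, used where no separation of the
  centres is asked for.\<close>

lemma zero_in_test_functions: "(\<lambda>x. 0) \<in> test_functions C"
proof -
  have "(\<lambda>x. 0) \<in> Cc_infinity" by (simp add: Cc_infinity_iff smooth_const)
  moreover have "esssup lebesgue (\<lambda>x::real^'a. 0 :: ereal) \<le> 1" by (rule esssup_I) auto
  ultimately show ?thesis by (simp add: test_functions_def flip: zero_ereal_def)
qed

theorem proposition3p1:
  fixes C :: "real^'n \<Rightarrow> real^'n^'n"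
    and S :: "real \<Rightarrow> (real^'n \<Rightarrow> complex) \<Rightarrow> (real^'n \<Rightarrow> complex)"
    and x\<^sub>1 x\<^sub>2 :: "real^'n" and r\<^sub>1 r\<^sub>2 t :: real
    and \<phi>\<^sub>1 \<phi>\<^sub>2 :: "real^'n \<Rightarrow> complex"
  assumes "coefficient_matrix C"
    and "viscosity_semigroup C S"
    and "r\<^sub>1 > 0" and "r\<^sub>2 > 0"
    and "\<phi>\<^sub>1 \<in> L2_on (B_C C x\<^sub>1 r\<^sub>1)" and "\<phi>\<^sub>2 \<in> L2_on (B_C C x\<^sub>2 r\<^sub>2)"
    and "t > 0"
  shows "cmod (L2_inner \<phi>\<^sub>1 (S t \<phi>\<^sub>2))
           \<le> exp_minus ((ball_distance C x\<^sub>1 r\<^sub>1 x\<^sub>2 r\<^sub>2)\<^sup>2 / ereal (4 * t)) * L2_norm \<phi>\<^sub>1 * L2_norm \<phi>\<^sub>2"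
proof -
  define X where "X = cmod (L2_inner \<phi>\<^sub>1 (S t \<phi>\<^sub>2))"
  define N where "N = L2_norm \<phi>\<^sub>1 * L2_norm \<phi>\<^sub>2"
  define b where "b = ball_distance C x\<^sub>1 r\<^sub>1 x\<^sub>2 r\<^sub>2"
  note bound = viscosity_semigroup_test_function_bound[OF assms(1,2) _ assms(5,6,7), folded X_def N_def]
  have X0: "X \<le> exp (- (0\<^sup>2 / (4 * t))) * N"
    by (rule bound[OF zero_in_test_functions]) auto
  \<comment> \<open>Strict inequality is essential: it yields a single test function separating the
    centres by more than D + r_1 + r_2. As D \<ge> 0, the maximum in \<open>ball_distance\<close>
    cannot be its zero branch.\<close>
  have XD: "X \<le> exp (- (D\<^sup>2 / (4 * t))) * N" if D: "0 \<le> D" "ereal D < b" for D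
  proof -
    have "ereal D < d_C C x\<^sub>1 x\<^sub>2 - ereal r\<^sub>1 - ereal r\<^sub>2"
      using D by (auto simp: b_def ball_distance_def max_def split: if_splits)
    then have "ereal (D + r\<^sub>1 + r\<^sub>2) < d_C C x\<^sub>1 x\<^sub>2"
      by (cases "d_C C x\<^sub>1 x\<^sub>2") auto
    then obtain \<psi> where \<psi>: "\<psi> \<in> test_functions C" "ereal (D + r\<^sub>1 + r\<^sub>2) < ereal \<bar>\<psi> x\<^sub>1 - \<psi> x\<^sub>2\<bar>"
      unfolding d_C_def less_SUP_iff by blast
    show ?thesis by (rule bound[OF \<psi>(1) D(1)]) (use \<psi>(2) in auto)
  qed
  have "0 \<le> b" by (simp add: b_def ball_distance_def)
  then consider "b = 0" | r where "b = ereal r" "0 < r" | "b = \<infinity>"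
    by (cases b) (auto simp: less_le zero_ereal_def)
  then have "X \<le> exp_minus (b\<^sup>2 / ereal (4 * t)) * N"
  proof cases
    case 1
    then show ?thesis using X0 by (simp add: exp_minus_def power2_eq_square)
  next
    case 2
    \<comment> \<open>The bound holds for all D in (0, r) and is continuous in D, so it persists as
      D increases to r.\<close>
    have "X \<le> exp (- (r\<^sup>2 / (4 * t))) * N"
    proof (rule tendsto_lowerbound)
      show "((\<lambda>D. exp (- (D\<^sup>2 / (4 * t))) * N) \<longlongrightarrow> exp (- (r\<^sup>2 / (4 * t))) * N) (at_left r)"
        using assms(7) by (intro tendsto_intros) auto
      show "\<forall>\<^sub>F D in at_left r. X \<le> exp (- (D\<^sup>2 / (4 * t))) * N"
        using eventually_at_left_real[OF 2(2)] by (rule eventually_mono) (use 2(1) in \<open>auto intro: XD\<close>)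
    qed simp
    moreover have "b\<^sup>2 / ereal (4 * t) = ereal (r\<^sup>2 / (4 * t))"
      using 2 assms(7) by (simp add: power2_eq_square)
    ultimately show ?thesis by (simp add: exp_minus_def)
  next
    case 3
    \<comment> \<open>At infinite distance every D \<ge> 0 is admissible, and D tending to infinity
      sends the Gaussian factor to 0, matching the convention in \<open>exp_minus\<close>.\<close>
    have "X \<le> 0 * N"
    proof (rule tendsto_lowerbound)
      have "filterlim (\<lambda>D::real. D\<^sup>2 / (4 * t)) at_top at_top"
        using filterlim_tendsto_pos_mult_at_top[OF tendsto_const _ filterlim_pow_at_top[OF _ filterlim_ident], of "1 / (4 * t)" 2]
          assms(7) by simp
      then have "((\<lambda>D::real. exp (- (D\<^sup>2 / (4 * t)))) \<longlongrightarrow> 0) at_top"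
        by (intro filterlim_compose[OF exp_at_bot] filterlim_uminus_at_bot[THEN iffD2]) simp
      then show "((\<lambda>D. exp (- (D\<^sup>2 / (4 * t))) * N) \<longlongrightarrow> 0 * N) at_top"
        by (rule tendsto_mult_right)
      show "\<forall>\<^sub>F D in at_top. X \<le> exp (- (D\<^sup>2 / (4 * t))) * N"
        using eventually_ge_at_top[of 0] by (rule eventually_mono) (use 3 in \<open>auto intro: XD\<close>)
    qed simp
    moreover have "b\<^sup>2 / ereal (4 * t) = \<infinity>"
      using 3 assms(7) by (simp add: power2_eq_square)
    ultimately show ?thesis by (simp add: exp_minus_def)
  qed
  then show ?thesis by (simp add: X_def N_def b_def mult.assoc)
qed

end
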